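(* Let $p$ be a prime. Suppose the finite group $A$ acts on a finite group $G$ by automorphisms. Let $B$ be a subnormal $p$-subgroup of $A$, where $p$ does not divide $|G|$. Let $C = \mathbf{C}_G(B)$ and write $\pi_B$ for the $B$-Glauberman correspondence. Let $C \leq H \leq G$ be an $A$-invariant subgroup, let $\chi \in \mathrm{Irr}_B(G)$ and let $\varphi \in \mathrm{Irr}_B(H)$ be the unique $B$-invariant irreducible character of $H$ such that $\pi_B(\chi) = \pi_B(\varphi)$. Then $A_\chi = A_\varphi$. Furthermore, for all $p$-subgroups $D \leq A_\chi$ such that $\mathbf{C}_G(D) \leq H$, one has $\pi_D(\chi) = \pi_D(\varphi)$.
   Context: All groups are finite and characters are complex. If a group $B$ acts by automorphisms on $G$, $\mathrm{Irr}_B(G)$ is the set of $B$-invariant irreducible characters of $G$, and $\mathbf{C}_G(B)$ is the subgroup of $B$-fixed points. For a character $\chi$, $A_\chi$ denotes the stabilizer of $\chi$ in $A$ under the induced action on characters. If $B$ is a $p$-group acting by automorphisms on a group $G$ of order not divisible by $p$, the $B$-Glauberman correspondence is the bijection $\pi_B: \mathrm{Irr}_B(G) \to \mathrm{Irr}(\mathbf{C}_G(B))$ where $\pi_B(\chi)$ is the unique irreducible constituent of $\chi_{\mathbf{C}_G(B)}$ whose multiplicity is not divisible by $p$. The same notation $\pi_B$ is used for the $B$-Glauberman correspondence of a $B$-invariant subgroup $H$ of $G$; when $\mathbf{C}_G(B) \le H$, one has $\mathbf{C}_H(B) = \mathbf{C}_G(B)$, so $\pi_B(\chi)$ and $\pi_B(\varphi)$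 are characters of the same group (and similarly for $D$). *)

theory Defs
  imports
    "Jordan_Normal_Form.VS_Connect"
    "HOL-Algebra.Bij"
    "HOL-Algebra.Group_Action"
    "HOL-Computational_Algebra.Primes"
begin

inductive subnormal :: "('a, 'm) monoid_scheme \<Rightarrow> 'a set \<Rightarrow> bool" for G where
  self: "subnormal G (carrier G)"
| step: "subnormal G K \<Longrightarrow> N \<lhd> G\<lparr>carrier := K\<rparr> \<Longrightarrow> subnormal G N"

definition p_subgroup :: "nat \<Rightarrow> 'a set \<Rightarrow> ('a, 'm) monoid_scheme \<Rightarrow> bool" where
  "p_subgroup p P G \<longleftrightarrow> subgroup P G \<and> (\<exists>k. card P = p ^ k)"

(* A complex matrix representation of degree n is a homomorphism into GL(n, C),
   the unit group of the matrix ring. *)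
definition representation ::
  "('g, 'm) monoid_scheme \<Rightarrow> nat \<Rightarrow> ('g \<Rightarrow> complex mat) \<Rightarrow> bool" where
  "representation G n \<rho> \<longleftrightarrow> \<rho> \<in> hom G (units_of (ring_mat TYPE(complex) n ()))"

definition irreducible_representation ::
  "('g, 'm) monoid_scheme \<Rightarrow> nat \<Rightarrow> ('g \<Rightarrow> complex mat) \<Rightarrow> bool" where
  "irreducible_representation G n \<rho> \<longleftrightarrow>
     representation G n \<rho> \<and> n > 0 \<and>
     (\<forall>W. VectorSpace.subspace class_ring W (module_vec TYPE(complex) n) \<and>
          (\<forall>g\<in>carrier G. \<forall>w\<in>W. \<rho> g *\<^sub>v w \<in> W)
        \<longrightarrow> W = {0\<^sub>v n} \<or> W = carrier_vec n)"

(* Characters are extensional functions (undefined off the carrier), so that equality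
   of HOL functions is equality of characters.  Consequently a subgroup K of G is always
   accompanied by its own group record G\<lparr>carrier := K\<rparr>. *)
definition character :: "('g, 'm) monoid_scheme \<Rightarrow> ('g \<Rightarrow> complex mat) \<Rightarrow> 'g \<Rightarrow> complex" where
  "character G \<rho> = (\<lambda>g\<in>carrier G. \<Sum>i<dim_row (\<rho> g). \<rho> g $$ (i, i))"

definition Irr :: "('g, 'm) monoid_scheme \<Rightarrow> ('g \<Rightarrow> complex) set" where
  "Irr G = {character G \<rho> | n \<rho>. irreducible_representation G n \<rho>}"

(* The coefficient of \<theta> in the decomposition of the character \<psi> of G into irreducible
   characters, which exists and is unique when G is a finite group (then Irr G is finite). *)
definition multiplicity ::
  "('g, 'm) monoid_scheme \<Rightarrow> ('g \<Rightarrow> complex) \<Rightarrow> ('g \<Rightarrow> complex) \<Rightarrow> nat" where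
  "multiplicity G \<psi> \<theta> =
     (THE k. \<exists>m :: ('g \<Rightarrow> complex) \<Rightarrow> nat.
        (\<forall>x\<in>carrier G. \<psi> x = (\<Sum>\<eta>\<in>Irr G. of_nat (m \<eta>) * \<eta> x)) \<and> k = m \<theta>)"

(* Below, act a is the automorphism given by the element a of the acting group.  The same
   act is used for the action on an invariant subgroup. *)

definition fixed_points :: "('a \<Rightarrow> 'g \<Rightarrow> 'g) \<Rightarrow> 'a set \<Rightarrow> ('g, 'm) monoid_scheme \<Rightarrow> 'g set" where
  "fixed_points act B G = {x \<in> carrier G. \<forall>b\<in>B. act b x = x}"

(* act is a left action, hence the inverse. *)
definition char_action ::
  "('a, 'l) monoid_scheme \<Rightarrow> ('a \<Rightarrow> 'g \<Rightarrow> 'g) \<Rightarrow> ('g, 'm) monoid_scheme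
     \<Rightarrow> 'a \<Rightarrow> ('g \<Rightarrow> complex) \<Rightarrow> 'g \<Rightarrow> complex" where
  "char_action A act G a \<chi> = (\<lambda>x\<in>carrier G. \<chi> (act (inv\<^bsub>A\<^esub> a) x))"

definition Irr_inv ::
  "('a, 'l) monoid_scheme \<Rightarrow> ('a \<Rightarrow> 'g \<Rightarrow> 'g) \<Rightarrow> 'a set \<Rightarrow> ('g, 'm) monoid_scheme
     \<Rightarrow> ('g \<Rightarrow> complex) set" where
  "Irr_inv A act B G = {\<chi> \<in> Irr G. \<forall>b\<in>B. char_action A act G b \<chi> = \<chi>}"

(* "Constituent" needs no separate clause: a multiplicity not divisible by p is nonzero. *)
definition glauberman ::
  "nat \<Rightarrow> ('a \<Rightarrow> 'g \<Rightarrow> 'g) \<Rightarrow> 'a set \<Rightarrow> ('g, 'm) monoid_scheme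
     \<Rightarrow> ('g \<Rightarrow> complex) \<Rightarrow> 'g \<Rightarrow> complex" where
  "glauberman p act B G \<chi> =
     (let C = G\<lparr>carrier := fixed_points act B G\<rparr>
      in THE \<theta>. \<theta> \<in> Irr C \<and> \<not> p dvd multiplicity C (restrict \<chi> (carrier C)) \<theta>)"

end

theory Submission
  imports Defs
    "Jordan_Normal_Form.Spectral_Radius"
    "Jordan_Normal_Form.Schur_Decomposition"
    "HOL-Algebra.Multiplicative_Group"
begin

text \<open>Write \<open>m(\<chi>, \<eta>)\<close> for the multiplicity of \<open>\<eta>\<close> in the restriction of \<open>\<chi>\<close> to a subgroup. The
  proof reduces the Glauberman correspondence to a statement about the residue of \<open>m(\<chi>, \<phi>)\<close>
  modulo \<open>p\<close>, which does not mention the acting \<open>p\<close>-group at all.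

  Let a \<open>p\<close>-group \<open>P\<close> act on the \<open>p'\<close>-group \<open>G\<close> with fixed points \<open>C\<close>. Orbits of \<open>P\<close> that are not
  single points have length divisible by \<open>p\<close>, so a sum of a \<open>P\<close>-invariant function agrees modulo
  \<open>p\<close> with the sum over the fixed points (\<open>p_group_sum_congruence\<close>). Congruences are taken in the
  ring of sums of roots of unity, where character values lie and whose rational elements are
  integers. Applied to the orthogonality relations of \<open>G\<close>, this principle yields information about
  the matrix of the numbers \<open>m(\<chi>, \<theta>)\<close>, with \<open>\<chi>\<close> a \<open>P\<close>-invariant irreducible character of \<open>G\<close> and
  \<open>\<theta>\<close> an irreducible character of \<open>C\<close>. The norm of \<open>\<chi>\<close> shows that no row vanishes modulo \<open>p\<close>
  (\<open>M_row_nonzero\<close>). The convolution of two distinct characters, which is zero, shows that no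
  column has two entries prime to \<open>p\<close> (\<open>M_column\<close>). The column relations show that distinct columns
  are orthogonal modulo \<open>p\<close> (\<open>M_columns_orthogonal\<close>), hence no row has two entries prime to \<open>p\<close>. So
  the correspondence is well defined and injective.

  If \<open>C \<subseteq> H \<subseteq> G\<close>, restricting from \<open>G\<close> to \<open>C\<close> in two steps and discarding the nontrivial orbits of
  \<open>P\<close> on the irreducible characters of \<open>H\<close> shows that invariant characters \<open>\<chi>\<close> of \<open>G\<close> and \<open>\<phi>\<close> of
  \<open>H\<close> have the same correspondent if and only if \<open>p\<close> does not divide \<open>m(\<chi>, \<phi>)\<close>
  (\<open>glauberman_eq_iff_res_mult\<close>). This gives the assertion about \<open>D\<close> as soon as both characters
  are known to be \<open>D\<close>-invariant.

  For the equality of the stabilizers one climbs a subnormal chain from \<open>B\<close> to \<open>A\<close>. Suppose that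
  the stabilizers agree on a member \<open>N\<close> of the chain, and that an element \<open>t\<close> of the next member
  fixes one of \<open>\<chi>\<close>, \<open>\<phi>\<close>. The conjugate of \<open>B\<close> by \<open>t\<close> lies in \<open>N\<close>, so it fixes both characters, and
  they correspond under it because \<open>p\<close> does not divide \<open>m(\<chi>, \<phi>)\<close>. Conjugating by \<open>t\<close> fixes
  one of them and does not change the multiplicity, so by injectivity it fixes the other as
  well.\<close>

section \<open>Traces and invariant subspaces of complex matrices\<close>

definition mat_trace :: "'a :: comm_ring_1 mat \<Rightarrow> 'a" where
  "mat_trace M = (\<Sum>i<dim_row M. M $$ (i, i))"

lemma mat_trace_mult:
  assumes "M \<in> carrier_mat n m" "N \<in> carrier_mat m n"
  shows "mat_trace (M * N) = (\<Sum>i<n. \<Sum>j<m. M $$ (i, j) * N $$ (j, i))"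
  using assms by (auto simp: mat_trace_def scalar_prod_def atLeast0LessThan intro!: sum.cong)

lemma mat_trace_comm:
  assumes "M \<in> carrier_mat n m" "N \<in> carrier_mat m n"
  shows "mat_trace (M * N) = mat_trace (N * M)"
  unfolding mat_trace_mult[OF assms] mat_trace_mult[OF assms(2,1)]
  by (subst sum.swap) (simp add: mult.commute)

lemma mat_trace_similar:
  assumes "M \<in> carrier_mat n n" "T \<in> carrier_mat n m" "T' \<in> carrier_mat m n" "T * T' = 1\<^sub>m n"
  shows "mat_trace (T' * M * T) = mat_trace M"
proof -
  have "mat_trace (T' * M * T) = mat_trace (T' * (M * T))"
    using assms by (simp add: assoc_mult_mat[of _ m n _ n _ m])
  also have "\<dots> = mat_trace ((M * T) * T')"
    by (rule mat_trace_comm[of _ m n]) (use assms in auto)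
  also have "(M * T) * T' = M"
    using assms by (simp add: assoc_mult_mat[of _ n n _ m _ n])
  finally show ?thesis .
qed

abbreviation mat_subspace :: "nat \<Rightarrow> complex vec set \<Rightarrow> bool" where
  "mat_subspace n W \<equiv> VectorSpace.subspace class_ring W (module_vec TYPE(complex) n)"

lemma mat_subspaceI:
  assumes "W \<subseteq> carrier_vec n" "0\<^sub>v n \<in> W"
    "\<And>v w. v \<in> W \<Longrightarrow> w \<in> W \<Longrightarrow> v + w \<in> W" "\<And>c v. v \<in> W \<Longrightarrow> c \<cdot>\<^sub>v v \<in> W"
  shows "mat_subspace n W"
  using assms vec_vs vec_module
  by (auto simp: VectorSpace.subspace_def submodule_def module_vec_simps)

lemma mat_subspaceD:
  assumes "mat_subspace n W"
  shows "W \<subseteq> carrier_vec n" "0\<^sub>v n \<in> W"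
    "\<And>v w. v \<in> W \<Longrightarrow> w \<in> W \<Longrightarrow> v + w \<in> W" "\<And>c v. v \<in> W \<Longrightarrow> c \<cdot>\<^sub>v v \<in> W"
  using assms
  by (auto simp: VectorSpace.subspace_def submodule_def module_vec_simps)

lemma det_nonzero_inverse:
  assumes "S \<in> carrier_mat n n" "det (S :: 'a :: field mat) \<noteq> 0"
  obtains S' where "S' \<in> carrier_mat n n" "S * S' = 1\<^sub>m n" "S' * S = 1\<^sub>m n"
  using det_non_zero_imp_unit[OF assms, of "()"] by (auto simp: Units_def ring_mat_def)

text \<open>Among the invertible matrices, one with as many leading columns in \<open>W\<close> as possible has
  a basis of \<open>W\<close> there: a vector of \<open>W\<close> with a nonzero coordinate at a later column could
  be exchanged against that column.\<close>
lemma adapted_basis_exists: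
  assumes W: "mat_subspace n W"
  obtains k S S' where "k \<le> n" "S \<in> carrier_mat n n" "S' \<in> carrier_mat n n"
    "S * S' = 1\<^sub>m n" "S' * S = 1\<^sub>m n" "\<And>i. i < k \<Longrightarrow> col S i \<in> W"
    "\<And>w i. w \<in> W \<Longrightarrow> k \<le> i \<Longrightarrow> i < n \<Longrightarrow> (S' *\<^sub>v w) $ i = 0"
proof -
  note W = mat_subspaceD[OF W]
  define Q where "Q k \<longleftrightarrow> k \<le> n \<and> (\<exists>S\<in>carrier_mat n n. det S \<noteq> 0 \<and> (\<forall>i<k. col S i \<in> W))" for k
  have Q0: "Q 0"
    unfolding Q_def by (intro conjI bexI[of _ "1\<^sub>m n"]) auto
  define k where "k = Greatest Q"
  have k: "Q k" and kmax: "\<And>j. Q j \<Longrightarrow> j \<le> k"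
    unfolding k_def using GreatestI_nat[of Q 0 n] Greatest_le_nat[of Q _ n] Q0
    by (auto simp: Q_def)
  then obtain S where S: "S \<in> carrier_mat n n" "det S \<noteq> 0" "\<forall>i<k. col S i \<in> W" and kn: "k \<le> n"
    by (auto simp: Q_def)
  obtain S' where S': "S' \<in> carrier_mat n n" "S * S' = 1\<^sub>m n" "S' * S = 1\<^sub>m n"
    using det_nonzero_inverse[OF S(1,2)] by blast
  have "(S' *\<^sub>v w) $ j = 0" if w: "w \<in> W" and j: "k \<le> j" "j < n" for w j
  proof (rule ccontr)
    assume nz: "(S' *\<^sub>v w) $ j \<noteq> 0"
    define v where "v = S' *\<^sub>v w"
    have wc: "w \<in> carrier_vec n" using w W(1) by auto
    have v: "v \<in> carrier_vec n" using S' wc by (auto simp: v_def)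
    have Sv: "S *\<^sub>v v = w"
      using S S' wc by (simp add: v_def assoc_mult_mat_vec[symmetric, of _ n n _ n])
    \<comment> \<open>exchange the columns \<open>k\<close> and \<open>j\<close>, then replace column \<open>k\<close> by \<open>w\<close>\<close>
    define E :: "complex mat" where
      "E = mat n n (\<lambda>(a, i). if i = k then v $ a else if i = j then (if a = k then 1 else 0)
             else if a = i then 1 else 0)"
    have E: "E \<in> carrier_mat n n" by (simp add: E_def)
    have "det E \<noteq> 0"
    proof
      assume "det E = 0"
      then obtain x where x: "x \<in> carrier_vec n" "x \<noteq> 0\<^sub>v n" "E *\<^sub>v x = 0\<^sub>v n"
        using det_0_iff_vec_prod_zero_field[OF E] by auto
      have row: "(\<Sum>i<n. E $$ (a, i) * x $ i) = 0" if "a < n" for a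
      proof -
        have "(\<Sum>i<n. E $$ (a, i) * x $ i) = (E *\<^sub>v x) $ a"
          using that E x(1) by (auto simp: scalar_prod_def atLeast0LessThan intro!: sum.cong)
        then show ?thesis using x(3) that by simp
      qed
      have "(\<Sum>i<n. E $$ (j, i) * x $ i) = (\<Sum>i<n. if i = k then v $ j * x $ k else 0)"
        using j by (intro sum.cong refl) (auto simp: E_def)
      then have xk: "x $ k = 0"
        using row[OF j(2)] j nz by (simp add: v_def)
      have xa: "x $ a = 0" if a: "a < n" "a \<noteq> j" for a
      proof (cases "a = k")
        case True then show ?thesis using xk by simp
      next
        case False
        have "(\<Sum>i<n. E $$ (a, i) * x $ i) = (\<Sum>i<n. if i = a then x $ a else 0)"
          using a False xk by (intro sum.cong refl) (auto simp: E_def)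
        then show ?thesis using row[OF a(1)] a by simp
      qed
      have "x $ j = 0"
      proof (cases "j = k")
        case True then show ?thesis using xk by simp
      next
        case False
        have kn': "k < n" using j by simp
        have "(\<Sum>i<n. E $$ (k, i) * x $ i) = (\<Sum>i<n. if i = j then x $ j else 0)"
          using xk xa kn' False by (intro sum.cong refl) (auto simp: E_def)
        then show ?thesis using row[OF kn'] j by simp
      qed
      with xa have "x $ i = 0" if "i < n" for i
        using that by (cases "i = j") auto
      with x(1) have "x = 0\<^sub>v n" by (intro eq_vecI) auto
      with x(2) show False by simp
    qed
    moreover have "col (S * E) i \<in> W" if i: "i < Suc k" for i
    proof (cases "i = k")
      case True
      have "col (S * E) k = S *\<^sub>v col E k"
        using S E j by (auto intro!: eq_vecI)
      also have "col E k = v"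
        using j v by (auto simp: E_def intro!: eq_vecI)
      finally show ?thesis using True Sv w by simp
    next
      case False
      have "col (S * E) i = S *\<^sub>v col E i"
        using S E i j by (auto intro!: eq_vecI)
      also have "col E i = unit_vec n i"
        using i j False by (auto simp: E_def unit_vec_def intro!: eq_vecI)
      also have "S *\<^sub>v unit_vec n i = col S i"
        using S i j by (auto intro!: eq_vecI)
      finally show ?thesis using S(3) i False by simp
    qed
    ultimately have "Q (Suc k)"
      using S E j det_mult[OF S(1) E] unfolding Q_def
      by (intro conjI bexI[of _ "S * E"]) auto
    then show False using kmax by fastforce
  qed
  with S S' kn show ?thesis by (intro that[of k S S']) auto
qed

section \<open>Representations and Schur's lemma\<close>

lemma units_ring_mat_simps:
  "carrier (units_of (ring_mat TYPE(complex) n ())) = Units (ring_mat TYPE(complex) n ())"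
  "monoid.mult (units_of (ring_mat TYPE(complex) n ())) = (*)"
  by (auto simp: units_of_def ring_mat_def)

lemma representationI:
  assumes "group G"
    and "\<And>g. g \<in> carrier G \<Longrightarrow> \<rho> g \<in> carrier_mat n n"
    and "\<And>g h. g \<in> carrier G \<Longrightarrow> h \<in> carrier G \<Longrightarrow> \<rho> (g \<otimes>\<^bsub>G\<^esub> h) = \<rho> g * \<rho> h"
    and "\<rho> \<one>\<^bsub>G\<^esub> = 1\<^sub>m n"
  shows "representation G n \<rho>"
proof -
  interpret group G by fact
  have "\<rho> g \<in> Units (ring_mat TYPE(complex) n ())" if g: "g \<in> carrier G" for g
  proof -
    have "\<rho> (inv\<^bsub>G\<^esub> g) * \<rho> g = 1\<^sub>m n" "\<rho> g * \<rho> (inv\<^bsub>G\<^esub> g) = 1\<^sub>m n"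
      using g assms(3)[of g "inv\<^bsub>G\<^esub> g"] assms(3)[of "inv\<^bsub>G\<^esub> g" g] assms(4) by simp_all
    then show ?thesis
      using assms(2)[OF g] assms(2)[of "inv\<^bsub>G\<^esub> g"] g
      by (auto simp: Units_def ring_mat_def)
  qed
  then show ?thesis
    using assms(3) by (auto simp: representation_def hom_def units_ring_mat_simps)
qed

locale mat_rep = group G for G :: "('g, 'm) monoid_scheme" (structure) +
  fixes n :: nat and \<rho> :: "'g \<Rightarrow> complex mat"
  assumes representation: "representation G n \<rho>"
begin

lemma carrier: "g \<in> carrier G \<Longrightarrow> \<rho> g \<in> carrier_mat n n"
  using representation by (auto simp: representation_def hom_def units_of_def Units_def ring_mat_def)

lemma mult: "g \<in> carrier G \<Longrightarrow> h \<in> carrier G \<Longrightarrow> \<rho> (g \<otimes> h) = \<rho> g * \<rho> h"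
  using representation by (auto simp: representation_def hom_def units_ring_mat_simps)

lemma one: "\<rho> \<one> = 1\<^sub>m n"
proof -
  have "\<rho> \<one> \<in> Units (ring_mat TYPE(complex) n ())"
    using representation by (auto simp: representation_def hom_def units_ring_mat_simps)
  then obtain T where T: "T \<in> carrier_mat n n" "T * \<rho> \<one> = 1\<^sub>m n"
    by (auto simp: Units_def ring_mat_def)
  have "\<rho> \<one> = (T * \<rho> \<one>) * \<rho> \<one>"
    using carrier[of \<one>] by (simp add: T)
  also have "\<dots> = T * (\<rho> \<one> * \<rho> \<one>)"
    by (rule assoc_mult_mat[OF T(1) carrier carrier]) simp_all
  also have "\<rho> \<one> * \<rho> \<one> = \<rho> \<one>"
    using mult[of \<one> \<one>] by simp
  finally show ?thesis using T by simp
qed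

lemma dim[simp]: "g \<in> carrier G \<Longrightarrow> dim_row (\<rho> g) = n" "g \<in> carrier G \<Longrightarrow> dim_col (\<rho> g) = n"
  using carrier by auto

lemma character_eq: "g \<in> carrier G \<Longrightarrow> character G \<rho> g = mat_trace (\<rho> g)"
  by (simp add: character_def mat_trace_def)

lemma mult_index:
  "g \<in> carrier G \<Longrightarrow> h \<in> carrier G \<Longrightarrow> i < n \<Longrightarrow> j < n \<Longrightarrow>
    \<rho> (g \<otimes> h) $$ (i, j) = (\<Sum>k<n. \<rho> g $$ (i, k) * \<rho> h $$ (k, j))"
  by (simp add: mult scalar_prod_def atLeast0LessThan)

end

text \<open>The kernel and the image of an intertwiner are invariant subspaces.\<close>
lemma schur_intertwiner_invertible:
  assumes G: "group G"
    and \<rho>: "irreducible_representation G n \<rho>" and \<sigma>: "irreducible_representation G m \<sigma>"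
    and T: "T \<in> carrier_mat n m" "T \<noteq> 0\<^sub>m n m"
    and inter: "\<And>g. g \<in> carrier G \<Longrightarrow> \<rho> g * T = T * \<sigma> g"
  obtains T' where "T' \<in> carrier_mat m n" "T * T' = 1\<^sub>m n" "T' * T = 1\<^sub>m m"
proof -
  interpret r: mat_rep G n \<rho>
    using G \<rho> by (simp add: mat_rep_def mat_rep_axioms_def irreducible_representation_def)
  interpret s: mat_rep G m \<sigma>
    using G \<sigma> by (simp add: mat_rep_def mat_rep_axioms_def irreducible_representation_def)
  define Ker where "Ker = {v \<in> carrier_vec m. T *\<^sub>v v = 0\<^sub>v n}"
  define Im where "Im = (\<lambda>v. T *\<^sub>v v) ` carrier_vec m"
  have "mat_subspace m Ker"
    unfolding Ker_def using T
    by (intro mat_subspaceI) (auto simp: mult_add_distrib_mat_vec[of _ n m] mult_mat_vec[of _ n m])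
  moreover have "\<sigma> g *\<^sub>v v \<in> Ker" if g: "g \<in> carrier G" and v: "v \<in> Ker" for g v
  proof -
    have "T *\<^sub>v (\<sigma> g *\<^sub>v v) = (\<rho> g * T) *\<^sub>v v"
      using T s.carrier[OF g] v by (simp add: inter[OF g] Ker_def assoc_mult_mat_vec[of _ n m _ m])
    also have "\<dots> = 0\<^sub>v n"
      using T r.carrier[OF g] v
      by (auto simp: Ker_def assoc_mult_mat_vec[of _ n n _ m] scalar_prod_def intro!: eq_vecI)
    finally show ?thesis using s.carrier[OF g] v by (auto simp: Ker_def)
  qed
  ultimately have Ker: "Ker = {0\<^sub>v m} \<or> Ker = carrier_vec m"
    using \<sigma> by (auto simp: irreducible_representation_def)
  have "mat_subspace n Im"
  proof (rule mat_subspaceI)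
    show "0\<^sub>v n \<in> Im" unfolding Im_def using T by (intro image_eqI[of _ _ "0\<^sub>v m"]) auto
    fix v w assume "v \<in> Im" "w \<in> Im"
    then obtain v' w' where "v = T *\<^sub>v v'" "w = T *\<^sub>v w'" "v' \<in> carrier_vec m" "w' \<in> carrier_vec m"
      by (auto simp: Im_def)
    then show "v + w \<in> Im" unfolding Im_def using T
      by (intro image_eqI[of _ _ "v' + w'"]) (auto simp: mult_add_distrib_mat_vec[of _ n m])
  next
    fix c v assume "v \<in> Im"
    then obtain v' where "v = T *\<^sub>v v'" "v' \<in> carrier_vec m"
      by (auto simp: Im_def)
    then show "c \<cdot>\<^sub>v v \<in> Im" unfolding Im_def using T
      by (intro image_eqI[of _ _ "c \<cdot>\<^sub>v v'"]) (auto simp: mult_mat_vec[of _ n m])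
  qed (use T in \<open>auto simp: Im_def\<close>)
  moreover have "\<rho> g *\<^sub>v v \<in> Im" if g: "g \<in> carrier G" and v: "v \<in> Im" for g v
  proof -
    obtain w where w: "w \<in> carrier_vec m" "v = T *\<^sub>v w" using v by (auto simp: Im_def)
    have "\<rho> g *\<^sub>v v = (\<rho> g * T) *\<^sub>v w"
      using T r.carrier[OF g] w by (simp add: assoc_mult_mat_vec[of _ n n _ m])
    also have "\<dots> = T *\<^sub>v (\<sigma> g *\<^sub>v w)"
      using T s.carrier[OF g] w by (simp add: inter[OF g] assoc_mult_mat_vec[of _ n m _ m])
    finally show ?thesis using s.carrier[OF g] w by (auto simp: Im_def)
  qed
  ultimately have Im: "Im = {0\<^sub>v n} \<or> Im = carrier_vec n"
    using \<rho> by (auto simp: irreducible_representation_def)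
  have cols0: "T = 0\<^sub>m n m" if "\<And>v. v \<in> carrier_vec m \<Longrightarrow> T *\<^sub>v v = 0\<^sub>v n"
  proof (rule eq_matI)
    fix i j assume ij: "i < dim_row (0\<^sub>m n m :: complex mat)" "j < dim_col (0\<^sub>m n m :: complex mat)"
    then have "T $$ (i, j) = (T *\<^sub>v unit_vec m j) $ i"
      using T(1) by auto
    then show "T $$ (i, j) = 0\<^sub>m n m $$ (i, j)"
      using that[of "unit_vec m j"] ij by simp
  qed (use T in auto)
  have "Ker = {0\<^sub>v m}"
    using Ker T(2) cols0 unfolding Ker_def by blast
  have "Im = carrier_vec n"
    using Im T(2) cols0 unfolding Im_def by blast
  then have "\<forall>i<n. \<exists>v. v \<in> carrier_vec m \<and> T *\<^sub>v v = unit_vec n i"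
    unfolding Im_def by (metis (no_types, lifting) imageE unit_vec_carrier)
  then obtain u where u: "\<And>i. i < n \<Longrightarrow> u i \<in> carrier_vec m" "\<And>i. i < n \<Longrightarrow> T *\<^sub>v u i = unit_vec n i"
    by metis
  define T' where "T' = mat m n (\<lambda>(a, i). u i $ a)"
  have T': "T' \<in> carrier_mat m n" by (simp add: T'_def)
  have colT': "col T' i = u i" if "i < n" for i
    using that u(1)[OF that] by (auto simp: T'_def intro!: eq_vecI)
  have TT': "T * T' = 1\<^sub>m n"
  proof (rule eq_matI)
    fix i j assume ij: "i < dim_row (1\<^sub>m n :: complex mat)" "j < dim_col (1\<^sub>m n :: complex mat)"
    then have "(T * T') $$ (i, j) = (T *\<^sub>v col T' j) $ i" using T T' by auto
    then show "(T * T') $$ (i, j) = 1\<^sub>m n $$ (i, j)" using ij u(2) colT' by auto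
  qed (use T T' in auto)
  have "T' * T = 1\<^sub>m m"
  proof (rule eq_matI)
    fix i j assume ij: "i < dim_row (1\<^sub>m m :: complex mat)" "j < dim_col (1\<^sub>m m :: complex mat)"
    define d where "d = T' *\<^sub>v col T j - unit_vec m j"
    have cT: "col T j \<in> carrier_vec n" using T by (auto simp: col_def)
    have d: "d \<in> carrier_vec m" using T' cT by (auto simp: d_def)
    have Tu: "T *\<^sub>v unit_vec m j = col T j" using T ij by (auto intro!: eq_vecI)
    have "T *\<^sub>v d = T *\<^sub>v (T' *\<^sub>v col T j) - T *\<^sub>v unit_vec m j"
      unfolding d_def using T T' cT by (intro mult_minus_distrib_mat_vec[of _ n m]) auto
    also have "T *\<^sub>v (T' *\<^sub>v col T j) = (T * T') *\<^sub>v col T j"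
      using T T' cT by (simp add: assoc_mult_mat_vec[of _ n m _ n])
    also have "\<dots> = col T j" using cT by (simp add: TT')
    finally have "T *\<^sub>v d = 0\<^sub>v n" using cT by (simp add: Tu)
    then have "d \<in> Ker" using d by (simp add: Ker_def)
    then have "d = 0\<^sub>v m" using \<open>Ker = {0\<^sub>v m}\<close> by simp
    then have "d $ i = 0" using ij by simp
    then have "(T' *\<^sub>v col T j) $ i = unit_vec m j $ i"
      using ij T' by (simp add: d_def)
    then show "(T' * T) $$ (i, j) = 1\<^sub>m m $$ (i, j)"
      using ij T T' by auto
  qed (use T T' in auto)
  with T' TT' show ?thesis by (rule that)
qed

text \<open>A nonzero intertwiner conjugates one representation into the other, and the trace is invariant
  under conjugation.\<close>
lemma schur_characters_eq:
  assumes G: "group G"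
    and \<rho>: "irreducible_representation G n \<rho>" and \<sigma>: "irreducible_representation G m \<sigma>"
    and T: "T \<in> carrier_mat n m" "T \<noteq> 0\<^sub>m n m"
    and inter: "\<And>g. g \<in> carrier G \<Longrightarrow> \<rho> g * T = T * \<sigma> g"
  shows "character G \<rho> = character G \<sigma>"
proof -
  interpret r: mat_rep G n \<rho>
    using G \<rho> by (simp add: mat_rep_def mat_rep_axioms_def irreducible_representation_def)
  interpret s: mat_rep G m \<sigma>
    using G \<sigma> by (simp add: mat_rep_def mat_rep_axioms_def irreducible_representation_def)
  obtain T' where T': "T' \<in> carrier_mat m n" "T * T' = 1\<^sub>m n" "T' * T = 1\<^sub>m m"
    using schur_intertwiner_invertible[OF assms] by blast
  have "mat_trace (\<rho> g) = mat_trace (\<sigma> g)" if g: "g \<in> carrier G" for g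
  proof -
    have "mat_trace (\<rho> g) = mat_trace (T' * \<rho> g * T)"
      by (rule mat_trace_similar[OF r.carrier[OF g] T(1) T'(1,2), symmetric])
    also have "T' * \<rho> g * T = T' * (T * \<sigma> g)"
      using assoc_mult_mat[OF T'(1) r.carrier[OF g] T(1)] by (simp add: inter[OF g])
    also have "\<dots> = T' * T * \<sigma> g"
      by (rule assoc_mult_mat[OF T'(1) T(1) s.carrier[OF g], symmetric])
    also have "\<dots> = \<sigma> g" using T' s.carrier[OF g] by simp
    finally show ?thesis .
  qed
  then show ?thesis
    by (auto simp: character_def mat_trace_def fun_eq_iff restrict_def)
qed

text \<open>Subtracting an eigenvalue makes an endomorphism singular, hence zero.\<close>
lemma schur_scalar:
  assumes G: "group G" and \<rho>: "irreducible_representation G n \<rho>"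
    and T: "T \<in> carrier_mat n n"
    and inter: "\<And>g. g \<in> carrier G \<Longrightarrow> \<rho> g * T = T * \<rho> g"
  obtains \<mu> where "T = \<mu> \<cdot>\<^sub>m 1\<^sub>m n"
proof -
  interpret r: mat_rep G n \<rho>
    using G \<rho> by (simp add: mat_rep_def mat_rep_axioms_def irreducible_representation_def)
  have n: "n > 0" using \<rho> by (simp add: irreducible_representation_def)
  obtain \<mu> where "eigenvalue T \<mu>"
    using spectrum_non_empty[OF T n] by (auto simp: spectrum_def)
  then obtain v where v: "v \<in> carrier_vec n" "v \<noteq> 0\<^sub>v n" "T *\<^sub>v v = \<mu> \<cdot>\<^sub>v v"
    using T by (auto simp: eigenvalue_def eigenvector_def)
  define U where "U = T - \<mu> \<cdot>\<^sub>m 1\<^sub>m n"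
  have U: "U \<in> carrier_mat n n" unfolding U_def by (intro minus_carrier_mat) simp
  have Uv: "U *\<^sub>v v = 0\<^sub>v n"
  proof -
    have "(\<mu> \<cdot>\<^sub>m 1\<^sub>m n) *\<^sub>v v = \<mu> \<cdot>\<^sub>v v"
      using v(1) by (auto simp: row_smult intro!: eq_vecI)
    then show ?thesis
      using T v by (simp add: U_def minus_mult_distrib_mat_vec[of _ n n])
  qed
  have "U = 0\<^sub>m n n"
  proof (rule ccontr)
    assume "U \<noteq> 0\<^sub>m n n"
    moreover have "\<rho> g * U = U * \<rho> g" if g: "g \<in> carrier G" for g
      using r.carrier[OF g] T inter[OF g]
      by (simp add: U_def mult_minus_distrib_mat[of _ n n _ n] minus_mult_distrib_mat[of _ n n _ _ n]
          mult_smult_distrib[of _ n n _ n] mult_smult_assoc_mat[of _ n n _ n])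
    ultimately obtain U' where U': "U' \<in> carrier_mat n n" "U' * U = 1\<^sub>m n"
      using schur_intertwiner_invertible[OF G \<rho> \<rho> U] by metis
    have "v = (U' * U) *\<^sub>v v" using U' v by simp
    also have "\<dots> = U' *\<^sub>v (U *\<^sub>v v)" using U U' v by (intro assoc_mult_mat_vec) auto
    also have "\<dots> = 0\<^sub>v n" using U' by (auto simp: Uv scalar_prod_def intro!: eq_vecI)
    finally show False using v by simp
  qed
  then have "T = \<mu> \<cdot>\<^sub>m 1\<^sub>m n"
    using T unfolding U_def by (auto simp: mat_eq_iff)
  then show ?thesis by (rule that)
qed

section \<open>Decomposition into irreducible characters\<close>

lemma sum_lessThan_split:
  fixes f :: "nat \<Rightarrow> 'a :: comm_monoid_add"
  assumes "k \<le> n"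
  shows "(\<Sum>l<n. f l) = (\<Sum>l<k. f l) + (\<Sum>l<n - k. f (l + k))"
proof -
  have "(\<Sum>l<n - k. f (l + k)) = (\<Sum>l\<in>{k..<n}. f l)"
    using assms sum.shift_bounds_nat_ivl[of f 0 k "n - k"] by (simp add: atLeast0LessThan)
  moreover have "{..<n} = {..<k} \<union> {k..<n}" using assms by auto
  ultimately show ?thesis by (simp add: sum.union_disjoint ivl_disj_int)
qed

lemma sum_list_count:
  fixes f :: "'a \<Rightarrow> 'b :: comm_semiring_1"
  assumes "set L \<subseteq> X" "finite X"
  shows "(\<Sum>x\<leftarrow>L. f x) = (\<Sum>x\<in>X. of_nat (count_list L x) * f x)"
  using assms(1)
proof (induction L)
  case (Cons a L)
  have "(\<Sum>x\<in>X. of_nat (count_list (a # L) x) * f x) =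
      (\<Sum>x\<in>X. (if x = a then f a else 0) + of_nat (count_list L x) * f x)"
    by (intro sum.cong refl) (simp add: distrib_right)
  then show ?case using Cons assms(2) by (simp add: sum.distrib)
qed simp

context mat_rep
begin

text \<open>In a basis adapted to \<open>W\<close> all matrices are block triangular with two diagonal blocks, and
  these are representations on \<open>W\<close> and on the quotient by \<open>W\<close>.\<close>
lemma invariant_subspace_splits:
  assumes W: "mat_subspace n W" "\<And>g w. g \<in> carrier G \<Longrightarrow> w \<in> W \<Longrightarrow> \<rho> g *\<^sub>v w \<in> W"
    and proper: "W \<noteq> {0\<^sub>v n}" "W \<noteq> carrier_vec n"
  obtains n1 n2 \<rho>1 \<rho>2 where "n1 < n" "n2 < n" "representation G n1 \<rho>1" "representation G n2 \<rho>2"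
    "\<And>g. g \<in> carrier G \<Longrightarrow> character G \<rho> g = character G \<rho>1 g + character G \<rho>2 g"
proof -
  note sub = mat_subspaceD[OF W(1)]
  obtain k S S' where kn: "k \<le> n" and S: "S \<in> carrier_mat n n" and S': "S' \<in> carrier_mat n n"
    and SS': "S * S' = 1\<^sub>m n" and S'S: "S' * S = 1\<^sub>m n"
    and colS: "\<And>i. i < k \<Longrightarrow> col S i \<in> W"
    and coord: "\<And>w i. w \<in> W \<Longrightarrow> k \<le> i \<Longrightarrow> i < n \<Longrightarrow> (S' *\<^sub>v w) $ i = 0"
    using adapted_basis_exists[OF W(1)] by metis
  have recover: "S *\<^sub>v (S' *\<^sub>v w) = w" if "w \<in> carrier_vec n" for w
    using that S S' by (simp add: assoc_mult_mat_vec[symmetric, of _ n n _ n] SS')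
  have "k \<noteq> 0"
  proof
    assume "k = 0"
    have "w = 0\<^sub>v n" if w: "w \<in> W" for w
    proof -
      have "S' *\<^sub>v w = 0\<^sub>v n"
        using coord[OF w] \<open>k = 0\<close> S' by (intro eq_vecI) auto
      then have "w = S *\<^sub>v 0\<^sub>v n" using recover[of w] w sub(1) by auto
      then show ?thesis using S by (auto simp: scalar_prod_def intro!: eq_vecI)
    qed
    then show False using proper(1) sub(2) by blast
  qed
  have "k \<noteq> n"
  proof
    assume "k = n"
    have "v \<in> W" if v: "v \<in> carrier_vec n" for v
    proof -
      define u where "u = S' *\<^sub>v v"
      have u: "u \<in> carrier_vec n" using S' v by (simp add: u_def)
      define part where "part t = vec n (\<lambda>i. if i < t then u $ i else 0)" for t :: nat
      have "t \<le> n \<Longrightarrow> S *\<^sub>v part t \<in> W" for t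
      proof (induction t)
        case 0
        have "S *\<^sub>v part 0 = 0\<^sub>v n"
          using S by (auto simp: part_def scalar_prod_def intro!: eq_vecI)
        then show ?case using sub(2) by simp
      next
        case (Suc t)
        have "part (Suc t) = part t + u $ t \<cdot>\<^sub>v unit_vec n t"
          by (auto simp: part_def unit_vec_def less_Suc_eq intro!: eq_vecI)
        then have "S *\<^sub>v part (Suc t) = S *\<^sub>v part t + S *\<^sub>v (u $ t \<cdot>\<^sub>v unit_vec n t)"
          using S by (simp add: mult_add_distrib_mat_vec[of _ n n] part_def)
        also have "S *\<^sub>v (u $ t \<cdot>\<^sub>v unit_vec n t) = u $ t \<cdot>\<^sub>v (S *\<^sub>v unit_vec n t)"
          using S by (intro mult_mat_vec) auto
        also have "S *\<^sub>v unit_vec n t = col S t"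
          using S Suc.prems by (auto intro!: eq_vecI)
        finally show ?case
          using Suc colS[of t] \<open>k = n\<close> sub(3,4) by auto
      qed
      from this[of n] have "S *\<^sub>v part n \<in> W" by simp
      moreover have "part n = u" using u by (auto simp: part_def intro!: eq_vecI)
      ultimately show ?thesis using recover[OF v] by (simp add: u_def)
    qed
    then show False using proper(2) sub(1) by blast
  qed
  define B where "B g = S' * \<rho> g * S" for g
  have Bc: "B g \<in> carrier_mat n n" if "g \<in> carrier G" for g
    using S S' carrier[OF that] by (simp add: B_def)
  have Bmult: "B (g \<otimes> h) = B g * B h" if g: "g \<in> carrier G" and h: "h \<in> carrier G" for g h
  proof -
    note gh = carrier[OF g] carrier[OF h]
    have c: "S' * \<rho> g \<in> carrier_mat n n" "\<rho> h * S \<in> carrier_mat n n" "S' * \<rho> h * S \<in> carrier_mat n n"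
      using gh S S' by (auto intro!: mult_carrier_mat[of _ n n _ n])
    have "B g * B h = S' * \<rho> g * (S * (S' * \<rho> h * S))"
      unfolding B_def by (rule assoc_mult_mat[OF c(1) S c(3)])
    also have "S * (S' * \<rho> h * S) = S * (S' * (\<rho> h * S))"
      by (simp only: assoc_mult_mat[OF S' gh(2) S])
    also have "\<dots> = (S * S') * (\<rho> h * S)"
      by (rule assoc_mult_mat[OF S S' c(2), symmetric])
    also have "\<dots> = \<rho> h * S"
      by (simp only: SS' left_mult_one_mat[OF c(2)])
    also have "S' * \<rho> g * (\<rho> h * S) = S' * \<rho> g * \<rho> h * S"
      by (rule assoc_mult_mat[OF c(1) gh(2) S, symmetric])
    also have "S' * \<rho> g * \<rho> h = S' * (\<rho> g * \<rho> h)"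
      by (rule assoc_mult_mat[OF S' gh])
    finally show ?thesis by (simp add: B_def mult[OF g h])
  qed
  have Bone: "B \<one> = 1\<^sub>m n"
    using S' by (simp add: B_def one S'S)
  have Bsum: "B (g \<otimes> h) $$ (i, j) = (\<Sum>l<n. B g $$ (i, l) * B h $$ (l, j))"
    if "g \<in> carrier G" "h \<in> carrier G" "i < n" "j < n" for g h i j
    using that Bc[of g] Bc[of h] by (auto simp: Bmult scalar_prod_def atLeast0LessThan)
  have B0: "B g $$ (i, j) = 0" if g: "g \<in> carrier G" and "k \<le> i" "i < n" "j < k" for g i j
  proof -
    have j: "j < n" using that kn by simp
    have "B g $$ (i, j) = (S' *\<^sub>v (\<rho> g *\<^sub>v col S j)) $ i"
    proof -
      have "B g = S' * (\<rho> g * S)"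
        unfolding B_def by (rule assoc_mult_mat[OF S' carrier[OF g] S])
      moreover have "col (\<rho> g * S) j = \<rho> g *\<^sub>v col S j"
        using S carrier[OF g] j by (auto intro!: eq_vecI)
      ultimately show ?thesis using that j S S' carrier[OF g] by simp
    qed
    then show ?thesis using coord W(2)[OF g colS[of j]] that by simp
  qed
  define \<rho>1 where "\<rho>1 g = mat k k (\<lambda>(i, j). B g $$ (i, j))" for g
  define \<rho>2 where "\<rho>2 g = mat (n - k) (n - k) (\<lambda>(i, j). B g $$ (i + k, j + k))" for g
  have "representation G k \<rho>1"
  proof (rule representationI)
    fix g h assume gh: "g \<in> carrier G" "h \<in> carrier G"
    show "\<rho>1 (g \<otimes> h) = \<rho>1 g * \<rho>1 h"
    proof (rule eq_matI)
      fix i j assume "i < dim_row (\<rho>1 g * \<rho>1 h)" "j < dim_col (\<rho>1 g * \<rho>1 h)"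
      then have ij: "i < k" "j < k" by (auto simp: \<rho>1_def)
      have "\<rho>1 (g \<otimes> h) $$ (i, j) = (\<Sum>l<k. B g $$ (i, l) * B h $$ (l, j))"
        using ij kn gh by (simp add: \<rho>1_def Bsum sum_lessThan_split[OF kn] B0)
      also have "\<dots> = (\<rho>1 g * \<rho>1 h) $$ (i, j)"
        using ij by (simp add: \<rho>1_def scalar_prod_def atLeast0LessThan)
      finally show "\<rho>1 (g \<otimes> h) $$ (i, j) = (\<rho>1 g * \<rho>1 h) $$ (i, j)" .
    qed (auto simp: \<rho>1_def)
  next
    show "\<rho>1 \<one> = 1\<^sub>m k"
      using kn by (auto simp: \<rho>1_def Bone intro!: eq_matI)
  qed (auto simp: \<rho>1_def)
  moreover have "representation G (n - k) \<rho>2"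
  proof (rule representationI)
    fix g h assume gh: "g \<in> carrier G" "h \<in> carrier G"
    show "\<rho>2 (g \<otimes> h) = \<rho>2 g * \<rho>2 h"
    proof (rule eq_matI)
      fix i j assume "i < dim_row (\<rho>2 g * \<rho>2 h)" "j < dim_col (\<rho>2 g * \<rho>2 h)"
      then have ij: "i < n - k" "j < n - k" by (auto simp: \<rho>2_def)
      have "\<rho>2 (g \<otimes> h) $$ (i, j) = (\<Sum>l<n - k. B g $$ (i + k, l + k) * B h $$ (l + k, j + k))"
        using ij kn gh by (simp add: \<rho>2_def Bsum sum_lessThan_split[OF kn] B0)
      also have "\<dots> = (\<rho>2 g * \<rho>2 h) $$ (i, j)"
        using ij by (simp add: \<rho>2_def scalar_prod_def atLeast0LessThan)
      finally show "\<rho>2 (g \<otimes> h) $$ (i, j) = (\<rho>2 g * \<rho>2 h) $$ (i, j)" .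
    qed (auto simp: \<rho>2_def)
  next
    show "\<rho>2 \<one> = 1\<^sub>m (n - k)"
      using kn by (auto simp: \<rho>2_def Bone intro!: eq_matI)
  qed (auto simp: \<rho>2_def)
  moreover have "character G \<rho> g = character G \<rho>1 g + character G \<rho>2 g" if g: "g \<in> carrier G" for g
  proof -
    have "character G \<rho> g = mat_trace (B g)"
      unfolding character_eq[OF g] B_def by (rule mat_trace_similar[OF carrier[OF g] S S' SS', symmetric])
    also have "\<dots> = (\<Sum>i<k. B g $$ (i, i)) + (\<Sum>i<n - k. B g $$ (i + k, i + k))"
      using Bc[OF g] by (simp add: mat_trace_def sum_lessThan_split[OF kn])
    finally show ?thesis
      using g by (simp add: character_def \<rho>1_def \<rho>2_def)
  qed
  ultimately show ?thesis
    using \<open>k \<noteq> 0\<close> \<open>k \<noteq> n\<close> kn by (intro that[of k "n - k" \<rho>1 \<rho>2]) auto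
qed

end

text \<open>A composition series suffices, because the trace does not see the off-diagonal block.\<close>
lemma character_decomposition:
  assumes "group G" "representation G n \<rho>"
  shows "\<exists>L. set L \<subseteq> Irr G \<and> (\<forall>g\<in>carrier G. character G \<rho> g = (\<Sum>\<eta>\<leftarrow>L. \<eta> g))"
  using assms(2)
proof (induction n arbitrary: \<rho> rule: less_induct)
  case (less n)
  interpret mat_rep G n \<rho>
    using assms(1) less.prems by (simp add: mat_rep_def mat_rep_axioms_def)
  consider "n = 0" | "irreducible_representation G n \<rho>" |
    W where "mat_subspace n W" "\<forall>g\<in>carrier G. \<forall>w\<in>W. \<rho> g *\<^sub>v w \<in> W" "W \<noteq> {0\<^sub>v n}" "W \<noteq> carrier_vec n"
    using less.prems unfolding irreducible_representation_def by blast
  then show ?case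
  proof cases
    case 1
    then show ?thesis by (intro exI[of _ "[]"]) (simp add: character_def)
  next
    case 2
    then have "character G \<rho> \<in> Irr G" by (auto simp: Irr_def)
    then show ?thesis by (intro exI[of _ "[character G \<rho>]"]) simp
  next
    case (3 W)
    obtain n1 n2 \<rho>1 \<rho>2 where s: "n1 < n" "n2 < n" "representation G n1 \<rho>1" "representation G n2 \<rho>2"
      "\<And>g. g \<in> carrier G \<Longrightarrow> character G \<rho> g = character G \<rho>1 g + character G \<rho>2 g"
      using invariant_subspace_splits[OF 3(1) _ 3(3,4)] 3(2) by metis
    obtain L1 where "set L1 \<subseteq> Irr G" "\<forall>g\<in>carrier G. character G \<rho>1 g = (\<Sum>\<eta>\<leftarrow>L1. \<eta> g)"
      using less.IH[OF s(1,3)] by blast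
    moreover obtain L2 where "set L2 \<subseteq> Irr G" "\<forall>g\<in>carrier G. character G \<rho>2 g = (\<Sum>\<eta>\<leftarrow>L2. \<eta> g)"
      using less.IH[OF s(2,4)] by blast
    ultimately show ?thesis
      using s(5) by (intro exI[of _ "L1 @ L2"]) auto
  qed
qed

section \<open>Orthogonality relations\<close>

locale fin_group = group G for G :: "('g, 'm) monoid_scheme" (structure) +
  assumes finite_carrier: "finite (carrier G)"
begin

lemma sum_translate_left:
  assumes "h \<in> carrier G"
  shows "(\<Sum>x\<in>carrier G. f (h \<otimes> x)) = (\<Sum>x\<in>carrier G. f x)"
  by (rule sum.reindex_bij_witness[of _ "\<lambda>x. inv h \<otimes> x" "\<lambda>x. h \<otimes> x"])
    (use assms in \<open>auto simp: m_assoc[symmetric]\<close>)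

lemma sum_inverse: "(\<Sum>x\<in>carrier G. f (inv x)) = (\<Sum>x\<in>carrier G. f x)"
  by (rule sum.reindex_bij_witness[of _ "\<lambda>x. inv x" "\<lambda>x. inv x"]) auto

lemma card_pos: "card (carrier G) > 0"
  using finite_carrier by (auto simp: card_gt_0_iff)

text \<open>For fixed inner indices \<open>a\<close>, \<open>b\<close> the sums form a matrix in the outer indices that
  intertwines the two representations: it is the average of the elementary matrix at \<open>(a, b)\<close>.\<close>
lemma average_intertwines:
  assumes "representation G n \<rho>" "representation G m \<sigma>" "a < n" "b < m" "h \<in> carrier G"
  defines "T \<equiv> mat n m (\<lambda>(i, j). \<Sum>g\<in>carrier G. \<rho> g $$ (i, a) * \<sigma> (inv g) $$ (b, j))"
  shows "\<rho> h * T = T * \<sigma> h"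
proof -
  interpret r: mat_rep G n \<rho> by unfold_locales fact
  interpret s: mat_rep G m \<sigma> by unfold_locales fact
  show ?thesis
  proof (rule eq_matI)
    fix i j assume "i < dim_row (T * \<sigma> h)" "j < dim_col (T * \<sigma> h)"
    then have ij: "i < n" "j < m" using assms by (auto simp: T_def)
    have "(\<rho> h * T) $$ (i, j) =
        (\<Sum>k<n. \<rho> h $$ (i, k) * (\<Sum>g\<in>carrier G. \<rho> g $$ (k, a) * \<sigma> (inv g) $$ (b, j)))"
      using ij assms by (simp add: T_def scalar_prod_def atLeast0LessThan)
    also have "\<dots> = (\<Sum>g\<in>carrier G. \<rho> (h \<otimes> g) $$ (i, a) * \<sigma> (inv g) $$ (b, j))"
      using ij assms by (simp add: r.mult_index sum_distrib_left sum_distrib_right)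
        (subst sum.swap, simp add: mult.assoc)
    also have "\<dots> = (\<Sum>g\<in>carrier G. \<rho> (h \<otimes> g) $$ (i, a) * \<sigma> (inv (h \<otimes> g) \<otimes> h) $$ (b, j))"
      using assms by (intro sum.cong refl) (simp add: inv_mult_group m_assoc)
    also have "\<dots> = (\<Sum>g\<in>carrier G. \<rho> g $$ (i, a) * \<sigma> (inv g \<otimes> h) $$ (b, j))"
      by (rule sum_translate_left[OF assms(5)])
    also have "\<dots> = (\<Sum>k<m. (\<Sum>g\<in>carrier G. \<rho> g $$ (i, a) * \<sigma> (inv g) $$ (b, k)) * \<sigma> h $$ (k, j))"
      using ij assms by (simp add: s.mult_index sum_distrib_left sum_distrib_right)
        (subst sum.swap, simp add: mult.assoc)
    also have "\<dots> = (T * \<sigma> h) $$ (i, j)"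
      using ij assms by (simp add: T_def scalar_prod_def atLeast0LessThan)
    finally show "(\<rho> h * T) $$ (i, j) = (T * \<sigma> h) $$ (i, j)" .
  qed (use assms in \<open>auto simp: T_def\<close>)
qed

lemma schur_relation_distinct:
  assumes "irreducible_representation G n \<rho>" "irreducible_representation G m \<sigma>"
    and "character G \<rho> \<noteq> character G \<sigma>" and "i < n" "a < n" "b < m" "j < m"
  shows "(\<Sum>g\<in>carrier G. \<rho> g $$ (i, a) * \<sigma> (inv g) $$ (b, j)) = 0"
proof -
  have reps: "representation G n \<rho>" "representation G m \<sigma>"
    using assms by (auto simp: irreducible_representation_def)
  define T where "T = mat n m (\<lambda>(i, j). \<Sum>g\<in>carrier G. \<rho> g $$ (i, a) * \<sigma> (inv g) $$ (b, j))"
  have "T = 0\<^sub>m n m"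
    using schur_characters_eq[OF is_group assms(1,2), of T]
      average_intertwines[OF reps assms(5,6)] assms(3)
    unfolding T_def by auto
  then have "T $$ (i, j) = 0\<^sub>m n m $$ (i, j)" by simp
  then show ?thesis using assms by (simp add: T_def)
qed

text \<open>The averaged matrix is scalar here; its trace determines the scalar.\<close>
lemma schur_relation_same:
  assumes irr: "irreducible_representation G n \<rho>" and "i < n" "a < n" "b < n" "j < n"
  shows "(\<Sum>g\<in>carrier G. \<rho> g $$ (i, a) * \<rho> (inv g) $$ (b, j)) =
    (if i = j \<and> a = b then of_nat (card (carrier G)) / of_nat n else 0)"
proof -
  interpret mat_rep G n \<rho>
    using irr by unfold_locales (simp add: irreducible_representation_def)
  define T where "T = mat n n (\<lambda>(i, j). \<Sum>g\<in>carrier G. \<rho> g $$ (i, a) * \<rho> (inv g) $$ (b, j))"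
  obtain \<mu> where \<mu>: "T = \<mu> \<cdot>\<^sub>m 1\<^sub>m n"
    using schur_scalar[OF is_group irr, of T]
      average_intertwines[OF representation representation assms(3,4)]
    unfolding T_def by auto
  have T: "(\<Sum>g\<in>carrier G. \<rho> g $$ (i, a) * \<rho> (inv g) $$ (b, j)) = (if i = j then \<mu> else 0)"
    if "i < n" "j < n" for i j
  proof -
    have "T $$ (i, j) = (if i = j then \<mu> else 0)" unfolding \<mu> using that by simp
    then show ?thesis using that by (simp add: T_def)
  qed
  have "of_nat n * \<mu> = (\<Sum>i<n. \<Sum>g\<in>carrier G. \<rho> g $$ (i, a) * \<rho> (inv g) $$ (b, i))"
    by (simp add: T)
  also have "\<dots> = (\<Sum>g\<in>carrier G. \<rho> (inv g \<otimes> g) $$ (b, a))"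
  proof (subst sum.swap, intro sum.cong refl)
    fix g assume "g \<in> carrier G"
    then show "(\<Sum>i<n. \<rho> g $$ (i, a) * \<rho> (inv g) $$ (b, i)) = \<rho> (inv g \<otimes> g) $$ (b, a)"
      using assms mult_index[of "inv g" g b a] by (simp add: mult.commute del: l_inv)
  qed
  also have "\<dots> = (\<Sum>g\<in>carrier G. if a = b then 1 else 0)"
    using assms by (intro sum.cong refl) (auto simp: one)
  also have "\<dots> = (if a = b then of_nat (card (carrier G)) else 0)" by simp
  finally have "\<mu> = (if a = b then of_nat (card (carrier G)) / of_nat n else 0)"
    using assms(2) by (auto simp: field_simps split: if_splits)
  then show ?thesis using T[OF assms(2,5)] by auto
qed

lemma Irr_cases:
  assumes "\<chi> \<in> Irr G"
  obtains n \<rho> where "irreducible_representation G n \<rho>" "mat_rep G n \<rho>" "n > 0" "\<chi> = character G \<rho>"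
    "\<chi> \<one> = of_nat n" "\<And>g. g \<in> carrier G \<Longrightarrow> \<chi> g = (\<Sum>i<n. \<rho> g $$ (i, i))"
proof -
  obtain n \<rho> where r: "irreducible_representation G n \<rho>" "\<chi> = character G \<rho>"
    using assms by (auto simp: Irr_def)
  interpret mat_rep G n \<rho>
    using r by unfold_locales (simp add: irreducible_representation_def)
  have "\<chi> g = (\<Sum>i<n. \<rho> g $$ (i, i))" if "g \<in> carrier G" for g
    using that r(2) by (simp add: character_def)
  with r show ?thesis
    by (intro that[of n \<rho>]) (auto simp: irreducible_representation_def one mat_rep_axioms)
qed

lemma Irr_one_nonzero: "\<chi> \<in> Irr G \<Longrightarrow> \<chi> \<one> \<noteq> 0"
  by (erule Irr_cases) simp

lemma Irr_extensional: "\<chi> \<in> Irr G \<Longrightarrow> \<chi> \<in> extensional (carrier G)"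
  by (auto simp: Irr_def character_def)

text \<open>In matrix entries the sum is a combination of the sums in the Schur relations. These leave
  only the trace at \<open>g\<close>, scaled by the order of the group over the degree.\<close>
lemma Irr_convolution:
  assumes "\<chi> \<in> Irr G" "\<psi> \<in> Irr G" "g \<in> carrier G"
  shows "(\<Sum>x\<in>carrier G. \<chi> x * \<psi> (inv x \<otimes> g)) =
    (if \<chi> = \<psi> then of_nat (card (carrier G)) / \<chi> \<one> * \<chi> g else 0)"
proof -
  obtain m \<sigma> where s: "irreducible_representation G m \<sigma>" "mat_rep G m \<sigma>" "m > 0" "\<psi> = character G \<sigma>"
    "\<psi> \<one> = of_nat m" "\<And>g. g \<in> carrier G \<Longrightarrow> \<psi> g = (\<Sum>i<m. \<sigma> g $$ (i, i))"
    by (rule Irr_cases[OF assms(2)], rule that)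
  interpret s: mat_rep G m \<sigma> by fact
  have expand: "(\<Sum>x\<in>carrier G. \<chi> x * \<psi> (inv x \<otimes> g)) =
     (\<Sum>i<n. \<Sum>b<m. \<Sum>k<m. \<sigma> g $$ (k, b) * (\<Sum>x\<in>carrier G. \<rho> x $$ (i, i) * \<sigma> (inv x) $$ (b, k)))"
    if "\<And>g. g \<in> carrier G \<Longrightarrow> \<chi> g = (\<Sum>i<n. \<rho> g $$ (i, i))" for n \<rho>
  proof -
    have "(\<Sum>x\<in>carrier G. \<chi> x * \<psi> (inv x \<otimes> g)) =
      (\<Sum>x\<in>carrier G. \<Sum>i<n. \<Sum>b<m. \<Sum>k<m. \<sigma> g $$ (k, b) * (\<rho> x $$ (i, i) * \<sigma> (inv x) $$ (b, k)))"
    proof (intro sum.cong refl)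
      fix x assume x: "x \<in> carrier G"
      have "\<psi> (inv x \<otimes> g) = (\<Sum>b<m. \<Sum>k<m. \<sigma> (inv x) $$ (b, k) * \<sigma> g $$ (k, b))"
        using x assms(3) by (simp add: s(6) s.mult_index)
      then have "\<chi> x * \<psi> (inv x \<otimes> g) =
          (\<Sum>i<n. \<Sum>b<m. \<Sum>k<m. \<rho> x $$ (i, i) * (\<sigma> (inv x) $$ (b, k) * \<sigma> g $$ (k, b)))"
        unfolding that[OF x] sum_distrib_right by (simp only: sum_distrib_left)
      also have "\<dots> = (\<Sum>i<n. \<Sum>b<m. \<Sum>k<m. \<sigma> g $$ (k, b) * (\<rho> x $$ (i, i) * \<sigma> (inv x) $$ (b, k)))"
        by (intro sum.cong refl) (simp only: mult_ac)
      finally show "\<chi> x * \<psi> (inv x \<otimes> g) =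
          (\<Sum>i<n. \<Sum>b<m. \<Sum>k<m. \<sigma> g $$ (k, b) * (\<rho> x $$ (i, i) * \<sigma> (inv x) $$ (b, k)))" .
    qed
    also have "\<dots> = (\<Sum>i<n. \<Sum>x\<in>carrier G. \<Sum>b<m. \<Sum>k<m. \<sigma> g $$ (k, b) * (\<rho> x $$ (i, i) * \<sigma> (inv x) $$ (b, k)))"
      by (rule sum.swap)
    also have "\<dots> = (\<Sum>i<n. \<Sum>b<m. \<Sum>x\<in>carrier G. \<Sum>k<m. \<sigma> g $$ (k, b) * (\<rho> x $$ (i, i) * \<sigma> (inv x) $$ (b, k)))"
      by (rule sum.cong[OF refl], rule sum.swap)
    also have "\<dots> = (\<Sum>i<n. \<Sum>b<m. \<Sum>k<m. \<Sum>x\<in>carrier G. \<sigma> g $$ (k, b) * (\<rho> x $$ (i, i) * \<sigma> (inv x) $$ (b, k)))"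
      by (rule sum.cong[OF refl], rule sum.cong[OF refl], rule sum.swap)
    finally show ?thesis by (simp add: sum_distrib_left)
  qed
  show ?thesis
  proof (cases "\<chi> = \<psi>")
    case True
    have "(\<Sum>x\<in>carrier G. \<chi> x * \<psi> (inv x \<otimes> g)) =
       (\<Sum>i<m. \<Sum>b<m. \<Sum>k<m. \<sigma> g $$ (k, b) * (if i = k \<and> i = b then of_nat (card (carrier G)) / of_nat m else 0))"
      using s(6) True by (subst expand[of \<sigma> m]) (auto simp: schur_relation_same[OF s(1)] intro!: sum.cong)
    also have "\<dots> = (\<Sum>i<m. \<Sum>b<m. if b = i then \<sigma> g $$ (i, i) * (of_nat (card (carrier G)) / of_nat m) else 0)"
    proof (intro sum.cong refl)
      fix i b assume "i \<in> {..<m}" "b \<in> {..<m}"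
      then have "(\<Sum>k<m. \<sigma> g $$ (k, b) * (if i = k \<and> i = b then of_nat (card (carrier G)) / of_nat m else 0))
        = (\<Sum>k<m. if k = i then (if b = i then \<sigma> g $$ (i, i) * (of_nat (card (carrier G)) / of_nat m) else 0) else 0)"
        by (intro sum.cong) auto
      then show "(\<Sum>k<m. \<sigma> g $$ (k, b) * (if i = k \<and> i = b then of_nat (card (carrier G)) / of_nat m else 0))
        = (if b = i then \<sigma> g $$ (i, i) * (of_nat (card (carrier G)) / of_nat m) else 0)"
        using \<open>i \<in> {..<m}\<close> by simp
    qed
    also have "\<dots> = (\<Sum>i<m. \<sigma> g $$ (i, i) * (of_nat (card (carrier G)) / of_nat m))"
      by (intro sum.cong) auto
    also have "\<dots> = of_nat (card (carrier G)) / \<chi> \<one> * \<chi> g"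
      unfolding True s(5) s(6)[OF assms(3)] sum_distrib_left by (simp only: mult.commute)
    finally show ?thesis using True by simp
  next
    case False
    obtain n \<rho> where r: "irreducible_representation G n \<rho>" "mat_rep G n \<rho>" "n > 0" "\<chi> = character G \<rho>"
      "\<chi> \<one> = of_nat n" "\<And>g. g \<in> carrier G \<Longrightarrow> \<chi> g = (\<Sum>i<n. \<rho> g $$ (i, i))"
      by (rule Irr_cases[OF assms(1)], rule that)
    have "character G \<rho> \<noteq> character G \<sigma>" using False r s by simp
    then show ?thesis
      using False by (simp add: expand[OF r(6)] schur_relation_distinct[OF r(1) s(1)])
  qed
qed

lemma Irr_orthogonality:
  assumes "\<chi> \<in> Irr G" "\<psi> \<in> Irr G"
  shows "(\<Sum>x\<in>carrier G. \<chi> x * \<psi> (inv x)) = (if \<chi> = \<psi> then of_nat (card (carrier G)) else 0)"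
  using Irr_convolution[OF assms, of \<one>] Irr_one_nonzero[OF assms(1)]
  by (cases "\<chi> = \<psi>") auto

text \<open>The sum of a conjugacy class acts as a scalar in an irreducible representation.\<close>
lemma Irr_product:
  assumes "\<chi> \<in> Irr G" "x \<in> carrier G" "y \<in> carrier G"
  shows "of_nat (card (carrier G)) * (\<chi> x * \<chi> y) = \<chi> \<one> * (\<Sum>g\<in>carrier G. \<chi> (x \<otimes> g \<otimes> y \<otimes> inv g))"
proof -
  obtain n \<rho> where r: "irreducible_representation G n \<rho>" "mat_rep G n \<rho>" "n > 0" "\<chi> = character G \<rho>"
    "\<chi> \<one> = of_nat n" "\<And>g. g \<in> carrier G \<Longrightarrow> \<chi> g = (\<Sum>i<n. \<rho> g $$ (i, i))"
    by (rule Irr_cases[OF assms(1)], rule that)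
  interpret mat_rep G n \<rho> by fact
  have "(\<Sum>g\<in>carrier G. \<chi> (x \<otimes> g \<otimes> y \<otimes> inv g)) = (\<Sum>g\<in>carrier G. \<chi> ((x \<otimes> g) \<otimes> (y \<otimes> inv g)))"
    using assms by (intro sum.cong refl) (simp add: m_assoc)
  also have "\<dots> = (\<Sum>g\<in>carrier G. \<Sum>i<n. \<Sum>k<n. \<Sum>j<n. \<Sum>l<n.
      \<rho> x $$ (i, j) * \<rho> y $$ (k, l) * (\<rho> g $$ (j, k) * \<rho> (inv g) $$ (l, i)))"
  proof (intro sum.cong refl)
    fix g assume g: "g \<in> carrier G"
    have "\<chi> ((x \<otimes> g) \<otimes> (y \<otimes> inv g)) = (\<Sum>i<n. \<Sum>k<n. (\<Sum>j<n. \<rho> x $$ (i, j) * \<rho> g $$ (j, k)) *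
        (\<Sum>l<n. \<rho> y $$ (k, l) * \<rho> (inv g) $$ (l, i)))"
      using g assms by (simp add: r(6) mult_index)
    also have "\<dots> = (\<Sum>i<n. \<Sum>k<n. \<Sum>j<n. \<Sum>l<n.
        \<rho> x $$ (i, j) * \<rho> y $$ (k, l) * (\<rho> g $$ (j, k) * \<rho> (inv g) $$ (l, i)))"
      unfolding sum_product by (intro sum.cong refl) (simp only: mult_ac)
    finally show "\<chi> ((x \<otimes> g) \<otimes> (y \<otimes> inv g)) = (\<Sum>i<n. \<Sum>k<n. \<Sum>j<n. \<Sum>l<n.
        \<rho> x $$ (i, j) * \<rho> y $$ (k, l) * (\<rho> g $$ (j, k) * \<rho> (inv g) $$ (l, i)))" .
  qed
  also have "\<dots> = (\<Sum>i<n. \<Sum>g\<in>carrier G. \<Sum>k<n. \<Sum>j<n. \<Sum>l<n.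
      \<rho> x $$ (i, j) * \<rho> y $$ (k, l) * (\<rho> g $$ (j, k) * \<rho> (inv g) $$ (l, i)))"
    by (rule sum.swap)
  also have "\<dots> = (\<Sum>i<n. \<Sum>k<n. \<Sum>g\<in>carrier G. \<Sum>j<n. \<Sum>l<n.
      \<rho> x $$ (i, j) * \<rho> y $$ (k, l) * (\<rho> g $$ (j, k) * \<rho> (inv g) $$ (l, i)))"
    by (rule sum.cong[OF refl], rule sum.swap)
  also have "\<dots> = (\<Sum>i<n. \<Sum>k<n. \<Sum>j<n. \<Sum>g\<in>carrier G. \<Sum>l<n.
      \<rho> x $$ (i, j) * \<rho> y $$ (k, l) * (\<rho> g $$ (j, k) * \<rho> (inv g) $$ (l, i)))"
    by (rule sum.cong[OF refl], rule sum.cong[OF refl], rule sum.swap)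
  also have "\<dots> = (\<Sum>i<n. \<Sum>k<n. \<Sum>j<n. \<Sum>l<n. \<Sum>g\<in>carrier G.
      \<rho> x $$ (i, j) * \<rho> y $$ (k, l) * (\<rho> g $$ (j, k) * \<rho> (inv g) $$ (l, i)))"
    by (rule sum.cong[OF refl], rule sum.cong[OF refl], rule sum.cong[OF refl], rule sum.swap)
  also have "\<dots> = (\<Sum>i<n. \<Sum>k<n. \<Sum>j<n. \<Sum>l<n. \<rho> x $$ (i, j) * \<rho> y $$ (k, l) *
      (if j = i \<and> k = l then of_nat (card (carrier G)) / of_nat n else 0))"
    by (auto simp: sum_distrib_left[symmetric] schur_relation_same[OF r(1)] intro!: sum.cong)
  also have "\<dots> = (\<Sum>i<n. \<Sum>k<n. \<rho> x $$ (i, i) * \<rho> y $$ (k, k) * (of_nat (card (carrier G)) / of_nat n))"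
  proof (intro sum.cong refl)
    fix i k assume ik: "i \<in> {..<n}" "k \<in> {..<n}"
    let ?c = "of_nat (card (carrier G)) / of_nat n :: complex"
    have "(\<Sum>l<n. \<rho> x $$ (i, j) * \<rho> y $$ (k, l) * (if j = i \<and> k = l then ?c else 0))
      = (if j = i then \<rho> x $$ (i, i) * \<rho> y $$ (k, k) * ?c else 0)" for j
    proof -
      have "(\<Sum>l<n. \<rho> x $$ (i, j) * \<rho> y $$ (k, l) * (if j = i \<and> k = l then ?c else 0))
        = (\<Sum>l<n. if l = k then (if j = i then \<rho> x $$ (i, i) * \<rho> y $$ (k, k) * ?c else 0) else 0)"
        by (intro sum.cong) auto
      then show ?thesis using ik by simp
    qed
    then show "(\<Sum>j<n. \<Sum>l<n. \<rho> x $$ (i, j) * \<rho> y $$ (k, l) * (if j = i \<and> k = l then ?c else 0))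
      = \<rho> x $$ (i, i) * \<rho> y $$ (k, k) * ?c"
      using ik by simp
  qed
  also have "\<dots> = (\<chi> x * \<chi> y) * (of_nat (card (carrier G)) / of_nat n)"
    unfolding r(6)[OF assms(2)] r(6)[OF assms(3)] sum_product unfolding sum_distrib_right ..
  finally show ?thesis using r(3,5) by (simp add: field_simps)
qed

text \<open>The character of the regular representation, whose matrices permute the elements of \<open>G\<close>: a
  translation by \<open>g \<noteq> \<one>\<close> moves all of them.\<close>
lemma regular_character:
  "\<exists>L. set L \<subseteq> Irr G \<and> (\<forall>g\<in>carrier G. (\<Sum>\<eta>\<leftarrow>L. \<eta> g) = (if g = \<one> then of_nat (card (carrier G)) else 0))"
proof -
  define N where "N = card (carrier G)"
  obtain e where e: "bij_betw e {..<N} (carrier G)"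
    using ex_bij_betw_nat_finite[OF finite_carrier] by (auto simp: N_def atLeast0LessThan)
  define \<rho> :: "'g \<Rightarrow> complex mat"
    where "\<rho> g = mat N N (\<lambda>(i, j). if e i = g \<otimes> e j then 1 else 0)" for g
  have eG: "e i \<in> carrier G" if "i < N" for i using e that by (auto simp: bij_betw_def)
  have einj: "e i = e j \<longleftrightarrow> i = j" if "i < N" "j < N" for i j
    using e that by (auto simp: bij_betw_def inj_on_eq_iff)
  have "representation G N \<rho>"
  proof (rule representationI)
    fix g h assume gh: "g \<in> carrier G" "h \<in> carrier G"
    show "\<rho> (g \<otimes> h) = \<rho> g * \<rho> h"
    proof (rule eq_matI)
      fix i j assume "i < dim_row (\<rho> g * \<rho> h)" "j < dim_col (\<rho> g * \<rho> h)"
      then have ij: "i < N" "j < N" by (auto simp: \<rho>_def)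
      have "h \<otimes> e j \<in> e ` {..<N}" using e gh ij eG by (simp add: bij_betw_def)
      then obtain k0 where k0: "k0 < N" "e k0 = h \<otimes> e j" by auto
      have "(\<rho> g * \<rho> h) $$ (i, j) = (\<Sum>k<N. (if e i = g \<otimes> e k then 1 else 0) * (if e k = h \<otimes> e j then 1 else 0))"
        using ij by (simp add: \<rho>_def scalar_prod_def atLeast0LessThan)
      also have "\<dots> = (\<Sum>k<N. if k = k0 then (if e i = g \<otimes> e k0 then 1 else 0) else 0)"
        using k0 einj by (intro sum.cong refl) (auto simp flip: k0(2))
      also have "\<dots> = (if e i = g \<otimes> (h \<otimes> e j) then 1 else 0)"
        using k0 by simp
      finally show "\<rho> (g \<otimes> h) $$ (i, j) = (\<rho> g * \<rho> h) $$ (i, j)"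
        using ij gh eG by (simp add: \<rho>_def m_assoc)
    qed (auto simp: \<rho>_def)
  next
    show "\<rho> \<one> = 1\<^sub>m N"
      using eG einj by (auto simp: \<rho>_def intro!: eq_matI)
  qed (auto simp: \<rho>_def is_group)
  moreover have "character G \<rho> g = (if g = \<one> then of_nat N else 0)" if g: "g \<in> carrier G" for g
  proof -
    have "character G \<rho> g = (\<Sum>i<N. if e i = g \<otimes> e i then 1 else 0)"
      using g by (simp add: character_def \<rho>_def)
    also have "\<dots> = (\<Sum>i<N. if g = \<one> then 1 else 0)"
      using g eG by (intro sum.cong refl) auto
    finally show ?thesis by simp
  qed
  ultimately show ?thesis
  proof -
    assume rep: "representation G N \<rho>"
      and char: "\<And>g. g \<in> carrier G \<Longrightarrow> character G \<rho> g = (if g = \<one> then of_nat N else 0)"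
    obtain L where "set L \<subseteq> Irr G" "\<forall>g\<in>carrier G. character G \<rho> g = (\<Sum>\<eta>\<leftarrow>L. \<eta> g)"
      using character_decomposition[OF is_group rep] by blast
    then show ?thesis
      using char unfolding N_def[symmetric] by (intro exI[of _ L]) simp
  qed
qed

lemma sum_list_Irr_inner:
  assumes "set L \<subseteq> Irr G" "\<theta> \<in> Irr G"
  shows "(\<Sum>x\<in>carrier G. (\<Sum>\<eta>\<leftarrow>L. \<eta> x) * \<theta> (inv x)) = of_nat (card (carrier G) * count_list L \<theta>)"
  using assms(1)
proof (induction L)
  case (Cons \<eta> L)
  then show ?case
    using Irr_orthogonality[of \<eta> \<theta>] assms(2)
    by (simp add: distrib_right sum.distrib algebra_simps)
qed simp

text \<open>Every irreducible character occurs in the regular character, so a decomposition of the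
  latter lists all of them, each as often as its degree says.\<close>
lemma finite_Irr: "finite (Irr G)"
  and Irr_degree_sum: "g \<in> carrier G \<Longrightarrow>
    (\<Sum>\<chi>\<in>Irr G. \<chi> \<one> * \<chi> g) = (if g = \<one> then of_nat (card (carrier G)) else 0)"
proof -
  obtain L where L: "set L \<subseteq> Irr G"
    "\<And>g. g \<in> carrier G \<Longrightarrow> (\<Sum>\<eta>\<leftarrow>L. \<eta> g) = (if g = \<one> then of_nat (card (carrier G)) else 0)"
    using regular_character by metis
  have deg: "of_nat (count_list L \<chi>) = \<chi> \<one>" if \<chi>: "\<chi> \<in> Irr G" for \<chi>
  proof -
    have "of_nat (card (carrier G) * count_list L \<chi>) = (\<Sum>x\<in>carrier G. (\<Sum>\<eta>\<leftarrow>L. \<eta> x) * \<chi> (inv x))"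
      by (rule sum_list_Irr_inner[OF L(1) \<chi>, symmetric])
    also have "\<dots> = (\<Sum>x\<in>carrier G. if x = \<one> then of_nat (card (carrier G)) * \<chi> \<one> else 0)"
      by (intro sum.cong refl) (auto simp: L(2))
    also have "\<dots> = of_nat (card (carrier G)) * \<chi> \<one>"
      using finite_carrier by simp
    finally show ?thesis using card_pos by simp
  qed
  have sub: "Irr G \<subseteq> set L"
  proof
    fix \<chi> assume \<chi>: "\<chi> \<in> Irr G"
    then have "count_list L \<chi> \<noteq> 0" using deg[OF \<chi>] Irr_one_nonzero[OF \<chi>] by (metis of_nat_0)
    then show "\<chi> \<in> set L" by (metis count_notin)
  qed
  then show "finite (Irr G)" by (rule finite_subset) simp
  assume g: "g \<in> carrier G"
  have "(\<Sum>\<chi>\<in>Irr G. \<chi> \<one> * \<chi> g) = (\<Sum>\<chi>\<in>set L. of_nat (count_list L \<chi>) * \<chi> g)"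
    using sub L(1) by (intro sum.cong) (auto simp: deg)
  also have "\<dots> = (\<Sum>\<eta>\<leftarrow>L. \<eta> g)"
    by (rule sum_list_count[symmetric]) simp_all
  finally show "(\<Sum>\<chi>\<in>Irr G. \<chi> \<one> * \<chi> g) = (if g = \<one> then of_nat (card (carrier G)) else 0)"
    using L(2)[OF g] by simp
qed

text \<open>\<open>Irr_product\<close> turns the product of two values into an average of single values, weighted by
  the degree; summed over all characters, such a value only detects the identity.\<close>
lemma Irr_column_orthogonality:
  assumes "x \<in> carrier G" "y \<in> carrier G"
  shows "(\<Sum>\<chi>\<in>Irr G. \<chi> x * \<chi> y) = of_nat (card {g \<in> carrier G. x \<otimes> g \<otimes> y \<otimes> inv g = \<one>})"
proof -
  let ?N = "of_nat (card (carrier G)) :: complex"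
  have "?N * (\<Sum>\<chi>\<in>Irr G. \<chi> x * \<chi> y) = (\<Sum>\<chi>\<in>Irr G. \<Sum>g\<in>carrier G. \<chi> \<one> * \<chi> (x \<otimes> g \<otimes> y \<otimes> inv g))"
    using assms by (simp add: sum_distrib_left Irr_product)
  also have "\<dots> = (\<Sum>g\<in>carrier G. \<Sum>\<chi>\<in>Irr G. \<chi> \<one> * \<chi> (x \<otimes> g \<otimes> y \<otimes> inv g))"
    by (rule sum.swap)
  also have "\<dots> = (\<Sum>g\<in>carrier G. if x \<otimes> g \<otimes> y \<otimes> inv g = \<one> then ?N else 0)"
    using assms by (intro sum.cong refl Irr_degree_sum) auto
  also have "\<dots> = ?N * of_nat (card {g \<in> carrier G. x \<otimes> g \<otimes> y \<otimes> inv g = \<one>})"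
    using finite_carrier by (simp add: sum.If_cases Int_def)
  finally show ?thesis using card_pos by simp
qed

text \<open>Orthogonality recovers the coefficient at \<open>\<theta>\<close> from the values, so the definite description
  in \<open>multiplicity\<close> refers to it.\<close>
lemma multiplicity_unique:
  assumes dec: "\<And>x. x \<in> carrier G \<Longrightarrow> \<psi> x = (\<Sum>\<eta>\<in>Irr G. of_nat (m \<eta>) * \<eta> x)" and \<theta>: "\<theta> \<in> Irr G"
  shows "multiplicity G \<psi> \<theta> = m \<theta>"
    and "(\<Sum>x\<in>carrier G. \<psi> x * \<theta> (inv x)) = of_nat (card (carrier G)) * of_nat (m \<theta>)"
proof -
  have inner: "(\<Sum>x\<in>carrier G. \<psi> x * \<theta> (inv x)) = of_nat (card (carrier G)) * of_nat (m' \<theta>)"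
    if "\<forall>x\<in>carrier G. \<psi> x = (\<Sum>\<eta>\<in>Irr G. of_nat (m' \<eta>) * \<eta> x)" for m'
  proof -
    have "(\<Sum>x\<in>carrier G. \<psi> x * \<theta> (inv x)) = (\<Sum>x\<in>carrier G. \<Sum>\<eta>\<in>Irr G. of_nat (m' \<eta>) * (\<eta> x * \<theta> (inv x)))"
      using that by (intro sum.cong refl) (simp add: sum_distrib_right mult.assoc)
    also have "\<dots> = (\<Sum>\<eta>\<in>Irr G. of_nat (m' \<eta>) * (\<Sum>x\<in>carrier G. \<eta> x * \<theta> (inv x)))"
      by (subst sum.swap) (simp add: sum_distrib_left)
    also have "\<dots> = (\<Sum>\<eta>\<in>Irr G. if \<eta> = \<theta> then of_nat (m' \<theta>) * of_nat (card (carrier G)) else 0)"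
      using \<theta> by (intro sum.cong refl) (auto simp: Irr_orthogonality)
    finally show ?thesis using \<theta> finite_Irr by (simp add: mult.commute)
  qed
  show "(\<Sum>x\<in>carrier G. \<psi> x * \<theta> (inv x)) = of_nat (card (carrier G)) * of_nat (m \<theta>)"
    using dec inner by simp
  show "multiplicity G \<psi> \<theta> = m \<theta>"
    unfolding multiplicity_def
  proof (rule the_equality)
    show "\<exists>m'. (\<forall>x\<in>carrier G. \<psi> x = (\<Sum>\<eta>\<in>Irr G. of_nat (m' \<eta>) * \<eta> x)) \<and> m \<theta> = m' \<theta>"
      using dec by blast
  next
    fix k assume "\<exists>m'. (\<forall>x\<in>carrier G. \<psi> x = (\<Sum>\<eta>\<in>Irr G. of_nat (m' \<eta>) * \<eta> x)) \<and> k = m' \<theta>"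
    then obtain m' where m': "\<forall>x\<in>carrier G. \<psi> x = (\<Sum>\<eta>\<in>Irr G. of_nat (m' \<eta>) * \<eta> x)" "k = m' \<theta>"
      by blast
    have "of_nat (card (carrier G)) * of_nat (m' \<theta>) = of_nat (card (carrier G)) * (of_nat (m \<theta>) :: complex)"
      using inner[OF m'(1)] inner[of m] dec by simp
    then show "k = m \<theta>" using card_pos m'(2) by simp
  qed
qed

lemma character_Irr_combination:
  assumes "representation G n \<rho>"
  obtains m :: "('g \<Rightarrow> complex) \<Rightarrow> nat"
  where "\<And>x. x \<in> carrier G \<Longrightarrow> character G \<rho> x = (\<Sum>\<eta>\<in>Irr G. of_nat (m \<eta>) * \<eta> x)"
proof -
  obtain L where L: "set L \<subseteq> Irr G" "\<forall>g\<in>carrier G. character G \<rho> g = (\<Sum>\<eta>\<leftarrow>L. \<eta> g)"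
    using character_decomposition[OF is_group assms] by blast
  show ?thesis
    by (rule that[of "count_list L"])
      (simp add: L sum_list_count[OF L(1) finite_Irr])
qed

end

section \<open>Sums of roots of unity\<close>

text \<open>The ring generated by all roots of unity. Closing under addition suffices, because
  products and negatives of roots of unity are again roots of unity.\<close>
inductive_set root_sums :: "complex set" where
  zero: "0 \<in> root_sums"
| step: "n > 0 \<Longrightarrow> z ^ n = 1 \<Longrightarrow> x \<in> root_sums \<Longrightarrow> z + x \<in> root_sums"

lemma root_sums_root: "n > 0 \<Longrightarrow> z ^ n = 1 \<Longrightarrow> z \<in> root_sums"
  using root_sums.step[OF _ _ root_sums.zero, of n z] by simp

lemma root_sums_add: "x \<in> root_sums \<Longrightarrow> y \<in> root_sums \<Longrightarrow> x + y \<in> root_sums"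
  by (induction rule: root_sums.induct) (auto simp: add.assoc intro: root_sums.step)

lemma root_sums_mult:
  assumes "x \<in> root_sums" "y \<in> root_sums"
  shows "x * y \<in> root_sums"
proof -
  have root: "z * y \<in> root_sums" if "n > 0" "z ^ n = 1" "y \<in> root_sums" for n and z y :: complex
    using that(3)
  proof (induction rule: root_sums.induct)
    case (step m w x)
    have "(z * w) ^ (n * m) = (z ^ n) ^ m * (w ^ m) ^ n"
      by (simp add: power_mult_distrib power_mult[symmetric] mult.commute)
    then have "z * w \<in> root_sums"
      using that step by (intro root_sums_root[of "n * m"]) auto
    then show ?case using step by (simp add: distrib_left root_sums_add)
  qed (simp add: root_sums.zero)
  show ?thesis
    using assms by (induction rule: root_sums.induct) (auto simp: distrib_right root root_sums_add root_sums.zero)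
qed

lemma root_sums_diff:
  assumes "x \<in> root_sums" "y \<in> root_sums"
  shows "x - y \<in> root_sums"
  using root_sums_add[OF assms(1) root_sums_mult[OF root_sums_root[of 2 "-1"] assms(2)]] by simp

lemma root_sums_sum: "(\<And>i. i \<in> I \<Longrightarrow> f i \<in> root_sums) \<Longrightarrow> (\<Sum>i\<in>I. f i) \<in> root_sums"
  by (induction I rule: infinite_finite_induct) (auto intro: root_sums.zero root_sums_add)

lemma root_sums_of_nat: "of_nat k \<in> root_sums"
  by (induction k) (auto intro: root_sums.zero root_sums.step[of 1 1])

text \<open>If the roots adding up to \<open>x\<close> are \<open>n\<close>-th roots of unity, then \<open>x\<close> times an \<open>n\<close>-th root is an
  integral combination of \<open>n\<close>-th roots. So the vector of all \<open>n\<close>-th roots is an eigenvector, with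
  eigenvalue \<open>x\<close>, of an integer matrix.\<close>
lemma root_sums_algebraic_int:
  assumes "x \<in> root_sums"
  shows "algebraic_int x"
proof -
  have "\<exists>n zs. n > 0 \<and> (\<forall>z\<in>set zs. z ^ n = 1) \<and> x = sum_list zs"
    using assms
  proof (induction rule: root_sums.induct)
    case zero
    show ?case by (intro exI[of _ 1] exI[of _ "[]"]) auto
  next
    case (step m w x)
    then obtain n zs where n: "n > 0" "\<forall>z\<in>set zs. z ^ n = 1" "x = sum_list zs" by blast
    have "z ^ (m * n) = 1" if "z \<in> set (w # zs)" for z
    proof (cases "z = w")
      case True then show ?thesis using step by (simp add: power_mult)
    next
      case False
      then have "z ^ n = 1" using that n by auto
      then show ?thesis by (simp add: mult.commute[of m] power_mult)
    qed
    then show ?case using n step by (intro exI[of _ "m * n"] exI[of _ "w # zs"]) auto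
  qed
  then obtain n zs where n: "n > 0" and zs: "\<forall>z\<in>set zs. z ^ n = 1" "x = sum_list zs" by blast
  obtain e where e: "bij_betw e {..<n} {z :: complex. z ^ n = 1}"
    using bij_betw_roots_unity[OF n] by blast
  define v where "v = vec n e"
  define A where "A = mat n n (\<lambda>(j, i). int (length (filter (\<lambda>z. z * e j = e i) zs)))"
  define M :: "complex mat" where "M = map_mat of_int A"
  have M: "M \<in> carrier_mat n n" by (simp add: M_def A_def)
  have e1: "e j ^ n = 1" if "j < n" for j using e that by (auto simp: bij_betw_def)
  have count: "(\<Sum>i<n. of_nat (length (filter (\<lambda>z. z * e j = e i) zs)) * e i) = sum_list zs * e j"
    if j: "j < n" for j
    using zs(1)
  proof (induction zs)
    case (Cons z zs)
    have "(z * e j) ^ n = 1" using Cons.prems e1[OF j] by (simp add: power_mult_distrib)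
    then have "z * e j \<in> e ` {..<n}" using e by (simp add: bij_betw_def)
    then obtain k where k: "k < n" "e k = z * e j" by auto
    have "z * e j = e i \<longleftrightarrow> i = k" if "i < n" for i
      using e k that by (auto simp: bij_betw_def inj_on_eq_iff simp flip: k(2))
    then have "(\<Sum>i<n. of_nat (length (filter (\<lambda>z. z * e j = e i) (z # zs))) * e i) =
        (\<Sum>i<n. (if i = k then e k else 0) + of_nat (length (filter (\<lambda>z. z * e j = e i) zs)) * e i)"
      by (intro sum.cong refl) (auto simp: distrib_right)
    then show ?case using Cons k by (simp add: sum.distrib distrib_right)
  qed simp
  have "M *\<^sub>v v = x \<cdot>\<^sub>v v"
  proof (rule eq_vecI)
    fix j assume "j < dim_vec (x \<cdot>\<^sub>v v)"
    then have j: "j < n" by (simp add: v_def)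
    have "(M *\<^sub>v v) $ j = (\<Sum>i<n. of_nat (length (filter (\<lambda>z. z * e j = e i) zs)) * e i)"
      using j by (simp add: M_def A_def v_def scalar_prod_def atLeast0LessThan)
    then show "(M *\<^sub>v v) $ j = (x \<cdot>\<^sub>v v) $ j" using j by (simp add: count zs(2) v_def)
  qed (use M in \<open>simp add: v_def\<close>)
  moreover have "v \<noteq> 0\<^sub>v n"
  proof
    assume "v = 0\<^sub>v n"
    then have "v $ 0 = 0" using n by simp
    then show False using e1[OF n] n by (simp add: v_def power_0_left)
  qed
  ultimately have "eigenvalue M x"
    using M unfolding eigenvalue_def eigenvector_def by (intro exI[of _ v]) (auto simp: v_def)
  then have "poly (char_poly M) x = 0" using eigenvalue_root_char_poly[OF M] by simp
  moreover have A: "A \<in> carrier_mat n n" by (simp add: A_def)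
  have "char_poly M = map_poly of_int (char_poly A)"
    unfolding M_def by (rule of_int_hom.char_poly_hom[OF A])
  then have "Polynomial.coeff (char_poly M) i \<in> \<int>" for i by (simp add: coeff_map_poly)
  moreover have "lead_coeff (char_poly M) = 1" using degree_monic_char_poly[OF M] by simp
  ultimately show ?thesis by (intro algebraic_int.intros[of "char_poly M"]) auto
qed

text \<open>Divisibility of integers may be tested in the larger ring, since \<open>a / p\<close> is rational.\<close>
lemma dvd_of_root_sums:
  assumes "of_nat a = of_nat p * r" "r \<in> root_sums"
  shows "p dvd a"
proof (cases "p = 0")
  case False
  have "r = of_nat a / of_nat p" using assms(1) False by simp
  then have "r \<in> \<rat>" by simp
  then have "r \<in> \<int>"
    using rational_algebraic_int_is_int root_sums_algebraic_int[OF assms(2)] by blast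
  then obtain k where "r = of_int k" by (auto elim: Ints_cases)
  then have "of_int (int a) = (of_int (int p * k) :: complex)" using assms(1) by simp
  then have "int a = int p * k" by (simp only: of_int_eq_iff)
  then show ?thesis by (metis dvd_triv_left int_dvd_int_iff)
qed (use assms in auto)

lemma (in mat_rep) pow: "g \<in> carrier G \<Longrightarrow> \<rho> (g [^] (k :: nat)) = \<rho> g ^\<^sub>m k"
  by (induction k) (simp_all add: one mult)

lemma mat_trace_eq_sum_list_diag: "mat_trace M = sum_list (diag_mat M)"
  by (simp add: mat_trace_def diag_mat_def sum_list_sum_nth atLeast0LessThan)

text \<open>After triangularization the trace is the sum of the eigenvalues, which are roots of unity as
  the matrix has finite order.\<close>
lemma (in fin_group) Irr_root_sums:
  assumes "\<chi> \<in> Irr G" "g \<in> carrier G"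
  shows "\<chi> g \<in> root_sums"
proof -
  obtain n \<rho> where r: "irreducible_representation G n \<rho>" "mat_rep G n \<rho>" "n > 0" "\<chi> = character G \<rho>"
    "\<chi> \<one> = of_nat n" "\<And>g. g \<in> carrier G \<Longrightarrow> \<chi> g = (\<Sum>i<n. \<rho> g $$ (i, i))"
    by (rule Irr_cases[OF assms(1)], rule that)
  interpret mat_rep G n \<rho> by fact
  have M: "\<rho> g \<in> carrier_mat n n" using carrier assms by simp
  obtain as where as: "char_poly (\<rho> g) = (\<Prod>a\<leftarrow>as. [:- a, 1:])"
    using char_poly_factorized[OF M] by blast
  obtain B P Q where "schur_decomposition (\<rho> g) as = (B, P, Q)"
    by (cases "schur_decomposition (\<rho> g) as") auto
  then have wit: "similar_mat_wit (\<rho> g) B P Q" and diag: "diag_mat B = as"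
    using schur_decomposition[OF M as] by auto
  note wit = similar_mat_witD2[OF M wit]
  have "\<chi> g = mat_trace (P * B * Q)"
    using wit(3) assms r(4) character_eq by simp
  also have "\<dots> = mat_trace B"
    by (rule mat_trace_similar[OF wit(5,7,6,2)])
  also have "\<dots> = sum_list as"
    by (simp add: mat_trace_eq_sum_list_diag diag)
  also have "set as' \<subseteq> set as \<Longrightarrow> sum_list as' \<in> root_sums" for as'
  proof (induction as')
    case (Cons a as')
    have "poly (char_poly (\<rho> g)) a = 0"
      using Cons.prems unfolding as by (auto simp: poly_prod_list prod_list_zero_iff)
    then have "eigenvalue (\<rho> g) a" using eigenvalue_root_char_poly[OF M] by simp
    then obtain v where v: "eigenvector (\<rho> g) v a" by (auto simp: eigenvalue_def)
    have vc: "v \<in> carrier_vec n" "v \<noteq> 0\<^sub>v n" using v M by (auto simp: eigenvector_def)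
    define N where "N = Coset.order G"
    have N: "N > 0" using card_pos by (simp add: N_def Coset.order_def)
    have "\<rho> g ^\<^sub>m N = 1\<^sub>m n"
      using pow[OF assms(2), of N] pow_order_eq_1[OF assms(2)] one by (simp add: N_def)
    then have "v = a ^ N \<cdot>\<^sub>v v"
      using eigenvector_pow[OF M v, of N] vc by simp
    moreover obtain i where "i < n" "v $ i \<noteq> 0"
      using vc by (metis carrier_vecD eq_vecI index_zero_vec)
    ultimately have "v $ i = a ^ N * v $ i"
      using vc by (metis carrier_vecD index_smult_vec(1))
    then have "a ^ N = 1" using \<open>v $ i \<noteq> 0\<close> by simp
    then show ?case
      using Cons N by (auto intro: root_sums.step)
  qed (simp add: root_sums.zero)
  then have "sum_list as \<in> root_sums" by simp
  finally show ?thesis .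
qed

section \<open>Actions of \<open>p\<close>-groups\<close>

text \<open>A nontrivial orbit of a \<open>p\<close>-group has length divisible by \<open>p\<close>, so it contributes a multiple
  of \<open>p\<close> to the sum of an invariant function.\<close>
lemma p_group_sum_congruence:
  fixes F :: "'x \<Rightarrow> complex" and P :: "('a, 'l) monoid_scheme" (structure)
  assumes P: "group P" "card (carrier P) = p ^ k" and p: "Factorial_Ring.prime p"
    and X: "finite X"
    and closed: "\<And>a x. a \<in> carrier P \<Longrightarrow> x \<in> X \<Longrightarrow> f a x \<in> X"
    and one: "\<And>x. x \<in> X \<Longrightarrow> f \<one> x = x"
    and mult: "\<And>a b x. a \<in> carrier P \<Longrightarrow> b \<in> carrier P \<Longrightarrow> x \<in> X \<Longrightarrow> f (a \<otimes> b) x = f a (f b x)"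
    and inv: "\<And>a x. a \<in> carrier P \<Longrightarrow> x \<in> X \<Longrightarrow> F (f a x) = F x"
    and F: "\<And>x. x \<in> X \<Longrightarrow> F x \<in> root_sums"
  obtains r where "r \<in> root_sums"
    "(\<Sum>x\<in>X. F x) = (\<Sum>x\<in>{x \<in> X. \<forall>a\<in>carrier P. f a x = x}. F x) + of_nat p * r"
proof -
  interpret P: group P by fact
  define \<phi> where "\<phi> a = restrict (f a) X" for a
  have \<phi>: "\<phi> a \<in> Bij X" if a: "a \<in> carrier P" for a
  proof -
    have "bij_betw (f a) X X"
      by (rule bij_betw_byWitness[where f' = "f (inv\<^bsub>P\<^esub> a)"])
        (use a closed one mult[symmetric] in \<open>auto simp: P.l_inv P.r_inv\<close>)
    then show ?thesis by (auto simp: Bij_def \<phi>_def cong: bij_betw_cong)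
  qed
  interpret group_action P X \<phi>
  proof (unfold group_action_def group_hom_def group_hom_axioms_def, intro conjI)
    show "\<phi> \<in> hom P (BijGroup X)"
    proof (rule homI)
      fix a b assume ab: "a \<in> carrier P" "b \<in> carrier P"
      then show "\<phi> (a \<otimes> b) = \<phi> a \<otimes>\<^bsub>BijGroup X\<^esub> \<phi> b"
        using \<phi> closed mult by (auto simp: BijGroup_def \<phi>_def compose_def)
    qed (simp add: \<phi> BijGroup_def)
  qed (use P group_BijGroup in auto)
  define fixed where "fixed = {x \<in> X. \<forall>a\<in>carrier P. f a x = x}"
  let ?O = "orbits P X \<phi>"
  have finO: "finite ?O"
    using X by (auto simp: orbits_def)
  have orb: "\<exists>x\<in>X. R = orbit P \<phi> x" if "R \<in> ?O" for R using that by (auto simp: orbits_def)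
  have orbF: "F y = F x" if "x \<in> X" "y \<in> orbit P \<phi> x" for x y
    using that inv by (auto simp: orbit_def \<phi>_def)
  have orbfix: "orbit P \<phi> x = {x}" if "x \<in> fixed" for x
    using that orbit_refl[of x] by (auto simp: orbit_def \<phi>_def fixed_def)
  have fixorb: "x \<in> fixed" if x: "x \<in> X" and c: "\<not> p dvd card (orbit P \<phi> x)" for x
  proof -
    have "card (orbit P \<phi> x) dvd p ^ k"
      using orbit_stabilizer_theorem[OF x] P(2) unfolding Coset.order_def by (metis dvd_triv_left)
    then obtain j where "card (orbit P \<phi> x) = p ^ j"
      using divides_primepow_nat[OF p] by auto
    then have "card (orbit P \<phi> x) = 1" using c by (cases j) auto
    then have "orbit P \<phi> x = {x}"
      using orbit_refl[OF x] by (auto simp: card_1_singleton_iff)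
    then have "f a x = x" if "a \<in> carrier P" for a
      using that x by (auto simp: orbit_def \<phi>_def)
    then show ?thesis using x by (simp add: fixed_def)
  qed
  have "\<exists>r. r \<in> root_sums \<and> (\<Sum>x\<in>R. F x) = (\<Sum>x\<in>R \<inter> fixed. F x) + of_nat p * r" if R: "R \<in> ?O" for R
  proof -
    obtain x where x: "x \<in> X" "R = orbit P \<phi> x" using orb[OF R] by blast
    show ?thesis
    proof (cases "p dvd card R")
      case True
      then obtain c where c: "card R = p * c" by blast
      have "R \<inter> fixed = {}"
      proof (rule ccontr)
        assume "R \<inter> fixed \<noteq> {}"
        then obtain y where y: "y \<in> R" "y \<in> fixed" by blast
        have yX: "y \<in> X" using y by (simp add: fixed_def)
        have "x \<in> orbit P \<phi> y" using orbit_sym[OF x(1) yX] y x by simp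
        then have "x = y" using orbfix[OF y(2)] by simp
        then have "card R = 1" using orbfix[OF y(2)] x by simp
        then show False using True p by simp
      qed
      moreover have "(\<Sum>y\<in>R. F y) = of_nat p * (of_nat c * F x)"
        using orbF[OF x(1)] x(2) c by (simp add: mult.assoc)
      ultimately show ?thesis
        using root_sums_mult[OF root_sums_of_nat F[OF x(1)], of c] by auto
    next
      case False
      then have "x \<in> fixed" using fixorb x by simp
      then have "R \<inter> fixed = R" using orbfix x by auto
      then show ?thesis using root_sums.zero by (intro exI[of _ 0]) simp
    qed
  qed
  then obtain r where r: "\<And>R. R \<in> ?O \<Longrightarrow> r R \<in> root_sums"
    "\<And>R. R \<in> ?O \<Longrightarrow> (\<Sum>x\<in>R. F x) = (\<Sum>x\<in>R \<inter> fixed. F x) + of_nat p * r R" by metis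
  have "finite R" if "R \<in> ?O" for R
    using that orbits_coverture X by (metis Union_upper finite_subset)
  then have res: "(\<Sum>x\<in>R \<inter> fixed. F x) = (\<Sum>x\<in>R. if x \<in> fixed then F x else 0)" if "R \<in> ?O" for R
    using that by (simp add: sum.inter_restrict)
  have "(\<Sum>x\<in>X. F x) = (\<Sum>R\<in>?O. \<Sum>x\<in>R. F x)"
    by (rule disjoint_sum[OF X, symmetric])
  also have "\<dots> = (\<Sum>R\<in>?O. \<Sum>x\<in>R. if x \<in> fixed then F x else 0) + of_nat p * (\<Sum>R\<in>?O. r R)"
    by (simp add: r(2) res sum.distrib sum_distrib_left)
  also have "(\<Sum>R\<in>?O. \<Sum>x\<in>R. if x \<in> fixed then F x else 0) = (\<Sum>x\<in>X. if x \<in> fixed then F x else 0)"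
    by (rule disjoint_sum[OF X])
  also have "\<dots> = (\<Sum>x\<in>fixed. F x)"
    using X by (intro sum.mono_neutral_cong_right) (auto simp: fixed_def)
  finally show ?thesis
    using that[of "\<Sum>R\<in>?O. r R"] root_sums_sum[of ?O r] r(1) unfolding fixed_def by simp
qed

section \<open>Restriction to subgroups\<close>

context fin_group
begin

abbreviation res_mult where
  "res_mult H \<chi> \<eta> \<equiv> multiplicity (G\<lparr>carrier := H\<rparr>) (restrict \<chi> H) \<eta>"

lemma fin_group_subgroup: "subgroup H G \<Longrightarrow> fin_group (G\<lparr>carrier := H\<rparr>)"
  using subgroup_imp_group finite_carrier
  by (auto simp: fin_group_def fin_group_axioms_def dest: subgroup.subset finite_subset)

text \<open>The restriction of \<open>\<chi>\<close> is the character of the restricted representation, so it decomposes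
  over \<open>H\<close> and its multiplicities are inner products.\<close>
lemma res_mult_inner:
  assumes H: "subgroup H G" and \<chi>: "\<chi> \<in> Irr G"
  shows "x \<in> H \<Longrightarrow> \<chi> x = (\<Sum>\<eta>\<in>Irr (G\<lparr>carrier := H\<rparr>). of_nat (res_mult H \<chi> \<eta>) * \<eta> x)"
    and "\<eta> \<in> Irr (G\<lparr>carrier := H\<rparr>) \<Longrightarrow>
      (\<Sum>x\<in>H. \<chi> x * \<eta> (inv x)) = of_nat (card H) * of_nat (res_mult H \<chi> \<eta>)"
proof -
  interpret H: fin_group "G\<lparr>carrier := H\<rparr>" by (rule fin_group_subgroup[OF H])
  have HG: "H \<subseteq> carrier G" using H by (rule subgroup.subset)
  obtain n \<rho> where r: "irreducible_representation G n \<rho>" "\<chi> = character G \<rho>"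
    using \<chi> by (auto simp: Irr_def)
  interpret mat_rep G n \<rho>
    using r by unfold_locales (simp add: irreducible_representation_def)
  have rep: "representation (G\<lparr>carrier := H\<rparr>) n \<rho>"
    by (rule representationI) (simp_all add: carrier mult one H.is_group subsetD[OF HG])
  obtain m where m: "\<And>x. x \<in> carrier (G\<lparr>carrier := H\<rparr>) \<Longrightarrow>
      character (G\<lparr>carrier := H\<rparr>) \<rho> x = (\<Sum>\<eta>\<in>Irr (G\<lparr>carrier := H\<rparr>). of_nat (m \<eta>) * \<eta> x)"
    by (rule H.character_Irr_combination[OF rep], rule that)
  have dec: "restrict \<chi> H x = (\<Sum>\<eta>\<in>Irr (G\<lparr>carrier := H\<rparr>). of_nat (m \<eta>) * \<eta> x)"
    if "x \<in> carrier (G\<lparr>carrier := H\<rparr>)" for x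
    using m[OF that] that HG by (auto simp: r(2) character_def)
  have uniq: "res_mult H \<chi> \<eta> = m \<eta>" if "\<eta> \<in> Irr (G\<lparr>carrier := H\<rparr>)" for \<eta>
    by (rule H.multiplicity_unique(1)[OF dec that])
  show "\<chi> x = (\<Sum>\<eta>\<in>Irr (G\<lparr>carrier := H\<rparr>). of_nat (res_mult H \<chi> \<eta>) * \<eta> x)" if "x \<in> H"
    using dec[of x] that by (simp add: uniq)
  show "(\<Sum>x\<in>H. \<chi> x * \<eta> (inv x)) = of_nat (card H) * of_nat (res_mult H \<chi> \<eta>)"
    if \<eta>: "\<eta> \<in> Irr (G\<lparr>carrier := H\<rparr>)"
  proof -
    have "(\<Sum>x\<in>H. \<chi> x * \<eta> (inv x)) = (\<Sum>x\<in>H. restrict \<chi> H x * \<eta> (inv\<^bsub>G\<lparr>carrier := H\<rparr>\<^esub> x))"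
      by (intro sum.cong refl) (simp add: m_inv_consistent[OF H])
    then show ?thesis using H.multiplicity_unique(2)[OF dec \<eta>] uniq[OF \<eta>] by simp
  qed
qed

lemma res_mult_eqI:
  assumes H: "subgroup H G" and "\<chi> \<in> Irr G" "\<chi>' \<in> Irr G"
    and "\<eta> \<in> Irr (G\<lparr>carrier := H\<rparr>)" "\<eta>' \<in> Irr (G\<lparr>carrier := H\<rparr>)"
    and "(\<Sum>x\<in>H. \<chi> x * \<eta> (inv x)) = (\<Sum>x\<in>H. \<chi>' x * \<eta>' (inv x))"
  shows "res_mult H \<chi> \<eta> = res_mult H \<chi>' \<eta>'"
proof -
  interpret H: fin_group "G\<lparr>carrier := H\<rparr>" by (rule fin_group_subgroup[OF H])
  show ?thesis
    using res_mult_inner(2)[OF H assms(2,4)] res_mult_inner(2)[OF H assms(3,5)] assms(6) H.card_pos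
    by simp
qed

end

section \<open>Groups acting by automorphisms\<close>

text \<open>The maps \<open>act a\<close> are constrained on the carrier of \<open>G\<close> only, so that the same \<open>act\<close> also acts on
  invariant subgroups.\<close>
locale automorphism_action = A: group A + fin_group G
  for A :: "('a, 'l) monoid_scheme" and G :: "('g, 'm) monoid_scheme" (structure) +
  fixes act :: "'a \<Rightarrow> 'g \<Rightarrow> 'g"
  assumes act_hom: "a \<in> carrier A \<Longrightarrow> act a \<in> hom G G"
    and act_mult: "a \<in> carrier A \<Longrightarrow> b \<in> carrier A \<Longrightarrow> x \<in> carrier G \<Longrightarrow> act (a \<otimes>\<^bsub>A\<^esub> b) x = act a (act b x)"
    and act_one: "x \<in> carrier G \<Longrightarrow> act \<one>\<^bsub>A\<^esub> x = x"
begin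

lemma act_closed [simp]: "a \<in> carrier A \<Longrightarrow> x \<in> carrier G \<Longrightarrow> act a x \<in> carrier G"
  using act_hom by (auto simp: hom_def)

lemma act_mult_hom: "a \<in> carrier A \<Longrightarrow> x \<in> carrier G \<Longrightarrow> y \<in> carrier G \<Longrightarrow> act a (x \<otimes> y) = act a x \<otimes> act a y"
  using act_hom by (auto simp: hom_def)

lemma act_group_hom: "a \<in> carrier A \<Longrightarrow> group_hom G G (act a)"
  using act_hom by (simp add: group_hom_def group_hom_axioms_def is_group)

lemma act_inv: "a \<in> carrier A \<Longrightarrow> x \<in> carrier G \<Longrightarrow> act a (inv x) = inv (act a x)"
  by (rule group_hom.hom_inv[OF act_group_hom])

lemma act_unit: "a \<in> carrier A \<Longrightarrow> act a \<one> = \<one>"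
  by (rule group_hom.hom_one[OF act_group_hom])

lemma act_inverse [simp]:
  "a \<in> carrier A \<Longrightarrow> x \<in> carrier G \<Longrightarrow> act (inv\<^bsub>A\<^esub> a) (act a x) = x"
  "a \<in> carrier A \<Longrightarrow> x \<in> carrier G \<Longrightarrow> act a (act (inv\<^bsub>A\<^esub> a) x) = x"
  by (simp_all add: act_mult[symmetric] act_one)

lemma sum_act: "a \<in> carrier A \<Longrightarrow> (\<Sum>x\<in>carrier G. f (act a x)) = (\<Sum>x\<in>carrier G. f x)"
  by (rule sum.reindex_bij_witness[of _ "act (inv\<^bsub>A\<^esub> a)" "act a"]) auto

lemma automorphism_action_subgroup:
  assumes "subgroup H G" "\<And>a x. a \<in> carrier A \<Longrightarrow> x \<in> H \<Longrightarrow> act a x \<in> H"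
  shows "automorphism_action A (G\<lparr>carrier := H\<rparr>) act"
  using assms fin_group_subgroup[OF assms(1)] subgroup.subset[OF assms(1)] A.is_group act_mult_hom act_mult act_one
  unfolding automorphism_action_def automorphism_action_axioms_def
  by (auto simp: hom_def subsetD)

abbreviation conj_char :: "'a \<Rightarrow> ('g \<Rightarrow> complex) \<Rightarrow> 'g \<Rightarrow> complex" where
  "conj_char \<equiv> char_action A act G"

lemma conj_char_apply: "x \<in> carrier G \<Longrightarrow> conj_char a \<chi> x = \<chi> (act (inv\<^bsub>A\<^esub> a) x)"
  by (simp add: char_action_def)

lemma conj_char_one: "\<chi> \<in> extensional (carrier G) \<Longrightarrow> conj_char \<one>\<^bsub>A\<^esub> \<chi> = \<chi>"
  by (auto simp: char_action_def act_one fun_eq_iff extensional_def)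

lemma conj_char_mult:
  "a \<in> carrier A \<Longrightarrow> b \<in> carrier A \<Longrightarrow> conj_char (a \<otimes>\<^bsub>A\<^esub> b) \<chi> = conj_char a (conj_char b \<chi>)"
  by (auto simp: char_action_def A.inv_mult_group act_mult fun_eq_iff)

lemma conj_char_Irr:
  assumes "\<chi> \<in> Irr G" "a \<in> carrier A"
  shows "conj_char a \<chi> \<in> Irr G"
proof -
  obtain n \<rho> where r: "irreducible_representation G n \<rho>" "\<chi> = character G \<rho>"
    using assms by (auto simp: Irr_def)
  interpret mat_rep G n \<rho>
    using r by unfold_locales (simp add: irreducible_representation_def)
  define b where "b = inv\<^bsub>A\<^esub> a"
  have b: "b \<in> carrier A" using assms by (simp add: b_def)
  define \<sigma> where "\<sigma> x = \<rho> (act b x)" for x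
  have "representation G n \<sigma>"
    by (rule representationI) (use b in \<open>auto simp: \<sigma>_def carrier mult one act_mult_hom act_unit is_group\<close>)
  moreover have "\<rho> g = \<sigma> (act a g)" if "g \<in> carrier G" for g
    using that assms by (simp add: \<sigma>_def b_def)
  then have "(\<forall>g\<in>carrier G. \<forall>w\<in>W. \<rho> g *\<^sub>v w \<in> W)" if "\<forall>g\<in>carrier G. \<forall>w\<in>W. \<sigma> g *\<^sub>v w \<in> W" for W
    using that assms by auto
  ultimately have "irreducible_representation G n \<sigma>"
    using r(1) unfolding irreducible_representation_def by blast
  moreover have "conj_char a \<chi> = character G \<sigma>"
    using b assms by (auto simp: char_action_def r(2) character_def \<sigma>_def b_def fun_eq_iff)
  ultimately show ?thesis by (auto simp: Irr_def)
qed

text \<open>Substituting the automorphism in the inner product over \<open>H\<close>.\<close>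
lemma res_mult_conj_char:
  assumes H: "subgroup H G" "\<And>a x. a \<in> carrier A \<Longrightarrow> x \<in> H \<Longrightarrow> act a x \<in> H"
    and \<chi>: "\<chi> \<in> Irr G" and \<eta>: "\<eta> \<in> Irr (G\<lparr>carrier := H\<rparr>)" and a: "a \<in> carrier A"
  shows "res_mult H (conj_char a \<chi>) (char_action A act (G\<lparr>carrier := H\<rparr>) a \<eta>) = res_mult H \<chi> \<eta>"
proof -
  interpret H: automorphism_action A "G\<lparr>carrier := H\<rparr>" act
    by (rule automorphism_action_subgroup[OF H])
  let ?b = "inv\<^bsub>A\<^esub> a"
  have HG: "H \<subseteq> carrier G" using H(1) by (rule subgroup.subset)
  have "(\<Sum>x\<in>H. conj_char a \<chi> x * H.conj_char a \<eta> (inv x)) = (\<Sum>x\<in>H. \<chi> (act ?b x) * \<eta> (inv (act ?b x)))"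
    using HG a subgroup.m_inv_closed[OF H(1)]
    by (intro sum.cong refl) (auto simp: conj_char_apply H.conj_char_apply act_inv subsetD)
  also have "\<dots> = (\<Sum>x\<in>H. \<chi> x * \<eta> (inv x))"
    using H.sum_act[of ?b "\<lambda>x. \<chi> x * \<eta> (inv x)"] a by simp
  finally show ?thesis
    by (rule res_mult_eqI[OF H(1) conj_char_Irr[OF \<chi> a] \<chi> H.conj_char_Irr[OF \<eta> a] \<eta>])
qed

end

section \<open>The Glauberman correspondence\<close>

locale coprime_p_action = automorphism_action A G act
  for A :: "('a, 'l) monoid_scheme" and G :: "('g, 'm) monoid_scheme" (structure)
    and act :: "'a \<Rightarrow> 'g \<Rightarrow> 'g" +
  fixes p :: nat and P :: "'a set"
  assumes prime: "Factorial_Ring.prime p" and P: "p_subgroup p P A"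
    and coprime: "\<not> p dvd card (carrier G)"
begin

definition C :: "'g set" where "C = fixed_points act P G"

abbreviation CG where "CG \<equiv> G\<lparr>carrier := C\<rparr>"

lemma P_subgroup: "subgroup P A" and P_card: "\<exists>k. card P = p ^ k"
  using P by (auto simp: p_subgroup_def)

lemma P_sub: "a \<in> P \<Longrightarrow> a \<in> carrier A"
  using subgroup.subset[OF P_subgroup] by auto

lemma C_subgroup: "subgroup C G"
proof (rule subgroupI)
  show "C \<noteq> {}" using act_unit P_sub by (auto simp: C_def fixed_points_def intro!: exI[of _ \<one>])
qed (auto simp: C_def fixed_points_def P_sub act_inv act_mult_hom)

sublocale C: fin_group CG
  by (rule fin_group_subgroup[OF C_subgroup])

lemma C_sub: "x \<in> C \<Longrightarrow> x \<in> carrier G" and C_fix: "x \<in> C \<Longrightarrow> a \<in> P \<Longrightarrow> act a x = x"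
  by (auto simp: C_def fixed_points_def)

lemma C_inv: "x \<in> C \<Longrightarrow> inv\<^bsub>CG\<^esub> x = inv x"
  by (rule m_inv_consistent[OF C_subgroup])

lemma C_closed [simp]: "x \<in> C \<Longrightarrow> inv x \<in> C" "x \<in> C \<Longrightarrow> y \<in> C \<Longrightarrow> x \<otimes> y \<in> C" "\<one> \<in> C"
  using C_subgroup by (auto simp: subgroup_def)

lemma coprime_C: "\<not> p dvd card C"
proof -
  have "card C dvd card (carrier G)"
    using lagrange[OF C_subgroup] unfolding Coset.order_def by (metis dvd_triv_right)
  then show ?thesis using coprime dvd_trans by blast
qed

lemma sum_congruence:
  fixes F :: "'x \<Rightarrow> complex"
  assumes "finite X" "\<And>a x. a \<in> P \<Longrightarrow> x \<in> X \<Longrightarrow> f a x \<in> X" "\<And>x. x \<in> X \<Longrightarrow> f \<one>\<^bsub>A\<^esub> x = x"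
    and "\<And>a b x. a \<in> P \<Longrightarrow> b \<in> P \<Longrightarrow> x \<in> X \<Longrightarrow> f (a \<otimes>\<^bsub>A\<^esub> b) x = f a (f b x)"
    and "\<And>a x. a \<in> P \<Longrightarrow> x \<in> X \<Longrightarrow> F (f a x) = F x" "\<And>x. x \<in> X \<Longrightarrow> F x \<in> root_sums"
  obtains r where "r \<in> root_sums"
    "(\<Sum>x\<in>X. F x) = (\<Sum>x\<in>{x \<in> X. \<forall>a\<in>P. f a x = x}. F x) + of_nat p * r"
proof -
  obtain k where k: "card P = p ^ k" using P_card by blast
  show ?thesis
    by (rule p_group_sum_congruence[of "A\<lparr>carrier := P\<rparr>" p k X f F])
      (use assms k prime A.subgroup_imp_group[OF P_subgroup] that in auto)
qed

lemma sum_fixed_points: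
  assumes "\<And>a x. a \<in> P \<Longrightarrow> x \<in> carrier G \<Longrightarrow> F (act a x) = F x" "\<And>x. x \<in> carrier G \<Longrightarrow> F x \<in> root_sums"
  obtains r where "r \<in> root_sums" "(\<Sum>x\<in>carrier G. F x) = (\<Sum>x\<in>C. F x) + of_nat p * r"
proof (rule sum_congruence[of "carrier G" act F])
  fix r assume "r \<in> root_sums"
    "(\<Sum>x\<in>carrier G. F x) = (\<Sum>x\<in>{x \<in> carrier G. \<forall>a\<in>P. act a x = x}. F x) + of_nat p * r"
  then show thesis using that by (simp add: C_def fixed_points_def)
qed (use assms finite_carrier act_mult act_one P_sub in auto)

lemma sum_Irr_inv:
  assumes "\<And>a \<chi>. a \<in> P \<Longrightarrow> \<chi> \<in> Irr G \<Longrightarrow> F (conj_char a \<chi>) = F \<chi>" "\<And>\<chi>. \<chi> \<in> Irr G \<Longrightarrow> F \<chi> \<in> root_sums"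
  obtains r where "r \<in> root_sums" "(\<Sum>\<chi>\<in>Irr G. F \<chi>) = (\<Sum>\<chi>\<in>Irr_inv A act P G. F \<chi>) + of_nat p * r"
proof (rule sum_congruence[of "Irr G" conj_char F])
  fix r assume "r \<in> root_sums"
    "(\<Sum>\<chi>\<in>Irr G. F \<chi>) = (\<Sum>\<chi>\<in>{\<chi> \<in> Irr G. \<forall>a\<in>P. conj_char a \<chi> = \<chi>}. F \<chi>) + of_nat p * r"
  then show thesis using that by (simp add: Irr_inv_def)
qed (use assms finite_Irr conj_char_mult conj_char_one conj_char_Irr Irr_extensional P_sub in auto)

lemma Irr_invD:
  assumes "\<chi> \<in> Irr_inv A act P G"
  shows "\<chi> \<in> Irr G" "\<And>a x. a \<in> P \<Longrightarrow> x \<in> carrier G \<Longrightarrow> \<chi> (act a x) = \<chi> x"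
proof -
  show "\<chi> \<in> Irr G" using assms by (simp add: Irr_inv_def)
  fix a x assume a: "a \<in> P" and x: "x \<in> carrier G"
  have "inv\<^bsub>A\<^esub> a \<in> P" using subgroup.m_inv_closed[OF P_subgroup a] .
  then have "conj_char (inv\<^bsub>A\<^esub> a) \<chi> x = \<chi> x" using assms by (simp add: Irr_inv_def)
  then show "\<chi> (act a x) = \<chi> x" using a x P_sub by (simp add: conj_char_apply)
qed

abbreviation M where "M \<equiv> res_mult C"

lemmas M_expand = res_mult_inner(1)[OF C_subgroup]
lemmas M_inner = res_mult_inner(2)[OF C_subgroup]

lemma M_inner':
  assumes "\<chi> \<in> Irr G" "\<theta> \<in> Irr CG"
  shows "(\<Sum>x\<in>C. \<chi> (inv x) * \<theta> x) = of_nat (card C) * of_nat (M \<chi> \<theta>)"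
proof -
  have "(\<Sum>x\<in>C. \<chi> (inv x) * \<theta> x) = (\<Sum>x\<in>C. \<chi> (inv x) * \<theta> (inv (inv x)))"
    using C_sub by (intro sum.cong refl) simp
  also have "\<dots> = (\<Sum>x\<in>C. \<chi> x * \<theta> (inv x))"
    using C.sum_inverse[of "\<lambda>x. \<chi> x * \<theta> (inv x)"] C_inv by simp
  finally show ?thesis using M_inner[OF assms] by simp
qed

text \<open>Compare the norm of \<open>\<chi>\<close> with that of its restriction: \<open>P\<close> fixes only the summands in \<open>C\<close>.\<close>
lemma M_row_nonzero:
  assumes \<chi>: "\<chi> \<in> Irr_inv A act P G"
  obtains \<theta> where "\<theta> \<in> Irr CG" "\<not> p dvd M \<chi> \<theta>"
proof (rule ccontr)
  assume "\<not> thesis"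
  then have dvd: "\<And>\<theta>. \<theta> \<in> Irr CG \<Longrightarrow> p dvd M \<chi> \<theta>" using that by blast
  note \<chi>D = Irr_invD[OF \<chi>]
  obtain r where r: "r \<in> root_sums"
    "(\<Sum>x\<in>carrier G. \<chi> x * \<chi> (inv x)) = (\<Sum>x\<in>C. \<chi> x * \<chi> (inv x)) + of_nat p * r"
    by (rule sum_fixed_points[of "\<lambda>x. \<chi> x * \<chi> (inv x)"])
      (use \<chi>D P_sub Irr_root_sums[OF \<chi>D(1)] in \<open>auto simp: act_inv[symmetric] intro!: root_sums_mult\<close>)
  have "(\<Sum>x\<in>C. \<chi> x * \<chi> (inv x)) = (\<Sum>x\<in>C. \<Sum>\<theta>\<in>Irr CG. of_nat (M \<chi> \<theta>) * (\<chi> (inv x) * \<theta> x))"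
    by (intro sum.cong refl, subst M_expand[OF \<chi>D(1)]) (auto simp: sum_distrib_left sum_distrib_right mult_ac)
  also have "\<dots> = (\<Sum>\<theta>\<in>Irr CG. of_nat (M \<chi> \<theta>) * (of_nat (card C) * of_nat (M \<chi> \<theta>)))"
    by (subst sum.swap) (simp add: sum_distrib_left[symmetric] M_inner'[OF \<chi>D(1)])
  also have "\<dots> = of_nat (\<Sum>\<theta>\<in>Irr CG. M \<chi> \<theta> * (card C * M \<chi> \<theta>))" by simp
  also obtain s where "(\<Sum>\<theta>\<in>Irr CG. M \<chi> \<theta> * (card C * M \<chi> \<theta>)) = p * s"
    using dvd by (meson dvdE dvd_mult2 dvd_sum)
  finally have "of_nat (card (carrier G)) = of_nat p * (of_nat s + r)"
    using r(2) Irr_orthogonality[OF \<chi>D(1) \<chi>D(1)] by (simp add: distrib_left)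
  then have "p dvd card (carrier G)"
    by (rule dvd_of_root_sums) (intro root_sums_add root_sums_of_nat r)
  then show False using coprime by simp
qed

text \<open>Only the constituent \<open>\<theta>\<close> of the restriction convolves with \<open>\<theta>\<close> to something nonzero.\<close>
lemma M_convolution:
  assumes "\<chi> \<in> Irr G" "\<theta> \<in> Irr CG" "c \<in> C"
  shows "(\<Sum>x\<in>C. \<chi> x * \<theta> (inv x \<otimes> c)) = of_nat (M \<chi> \<theta>) * (of_nat (card C) / \<theta> \<one> * \<theta> c)"
proof -
  have "(\<Sum>x\<in>C. \<chi> x * \<theta> (inv x \<otimes> c)) =
      (\<Sum>x\<in>C. \<Sum>\<eta>\<in>Irr CG. of_nat (M \<chi> \<eta>) * (\<eta> x * \<theta> (inv\<^bsub>CG\<^esub> x \<otimes> c)))"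
    by (intro sum.cong refl, subst M_expand[OF assms(1)]) (auto simp: sum_distrib_left sum_distrib_right mult_ac C_inv)
  also have "\<dots> = (\<Sum>\<eta>\<in>Irr CG. of_nat (M \<chi> \<eta>) * (\<Sum>x\<in>C. \<eta> x * \<theta> (inv\<^bsub>CG\<^esub> x \<otimes> c)))"
    by (subst sum.swap) (simp add: sum_distrib_left)
  also have "\<dots> = (\<Sum>\<eta>\<in>Irr CG. if \<eta> = \<theta> then of_nat (M \<chi> \<theta>) * (of_nat (card C) / \<theta> \<one> * \<theta> c) else 0)"
    using C.Irr_convolution[OF _ assms(2), of _ c] assms by (intro sum.cong refl) auto
  finally show ?thesis using assms C.finite_Irr by simp
qed

text \<open>Distinct irreducible characters of \<open>G\<close> convolve to zero, hence modulo \<open>p\<close> so do their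
  restrictions to \<open>C\<close>. The coefficient at \<open>\<theta>\<close> of the latter convolution is, up to a factor prime
  to \<open>p\<close>, the product of the two multiplicities.\<close>
lemma M_column:
  assumes \<chi>: "\<chi> \<in> Irr_inv A act P G" and \<psi>: "\<psi> \<in> Irr_inv A act P G" and ne: "\<chi> \<noteq> \<psi>"
    and \<theta>: "\<theta> \<in> Irr CG"
  shows "p dvd M \<chi> \<theta> \<or> p dvd M \<psi> \<theta>"
proof -
  note \<chi>D = Irr_invD[OF \<chi>] note \<psi>D = Irr_invD[OF \<psi>]
  have "\<exists>r. r \<in> root_sums \<and> (\<Sum>x\<in>C. \<chi> x * \<psi> (inv x \<otimes> c)) + of_nat p * r = 0" if c: "c \<in> C" for c
  proof -
    have cG: "c \<in> carrier G" using c C_sub by simp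
    have inv: "act a (inv x \<otimes> c) = inv (act a x) \<otimes> c" if "a \<in> P" "x \<in> carrier G" for a x
      using that c cG P_sub by (simp add: act_mult_hom act_inv C_fix)
    obtain r where "r \<in> root_sums"
      "(\<Sum>x\<in>carrier G. \<chi> x * \<psi> (inv x \<otimes> c)) = (\<Sum>x\<in>C. \<chi> x * \<psi> (inv x \<otimes> c)) + of_nat p * r"
    proof (rule sum_fixed_points[of "\<lambda>x. \<chi> x * \<psi> (inv x \<otimes> c)"])
      fix a x assume "a \<in> P" "x \<in> carrier G"
      then show "\<chi> (act a x) * \<psi> (inv (act a x) \<otimes> c) = \<chi> x * \<psi> (inv x \<otimes> c)"
        using \<chi>D(2)[of a x] \<psi>D(2)[of a "inv x \<otimes> c"] cG by (simp add: inv)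
    qed (use cG Irr_root_sums \<chi>D(1) \<psi>D(1) in \<open>auto intro!: root_sums_mult\<close>)
    then show ?thesis using Irr_convolution[OF \<chi>D(1) \<psi>D(1) cG] ne by auto
  qed
  then obtain r where r: "\<And>c. c \<in> C \<Longrightarrow> r c \<in> root_sums"
    "\<And>c. c \<in> C \<Longrightarrow> (\<Sum>x\<in>C. \<chi> x * \<psi> (inv x \<otimes> c)) + of_nat p * r c = 0" by metis
  let ?k = "of_nat (card C) :: complex"
  have conv: "(\<Sum>x\<in>C. \<chi> x * \<psi> (inv x \<otimes> c)) = (\<Sum>\<eta>\<in>Irr CG. of_nat (M \<psi> \<eta> * M \<chi> \<eta>) * (?k / \<eta> \<one>) * \<eta> c)"
    if c: "c \<in> C" for c
  proof -
    have "(\<Sum>x\<in>C. \<chi> x * \<psi> (inv x \<otimes> c)) =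
        (\<Sum>x\<in>C. \<Sum>\<eta>\<in>Irr CG. of_nat (M \<psi> \<eta>) * (\<chi> x * \<eta> (inv x \<otimes> c)))"
      using c by (intro sum.cong refl, subst M_expand[OF \<psi>D(1)]) (auto simp: sum_distrib_left mult_ac)
    also have "\<dots> = (\<Sum>\<eta>\<in>Irr CG. of_nat (M \<psi> \<eta>) * (\<Sum>x\<in>C. \<chi> x * \<eta> (inv x \<otimes> c)))"
      by (subst sum.swap) (simp add: sum_distrib_left)
    also have "\<dots> = (\<Sum>\<eta>\<in>Irr CG. of_nat (M \<psi> \<eta> * M \<chi> \<eta>) * (?k / \<eta> \<one>) * \<eta> c)"
      using c by (intro sum.cong refl) (simp add: M_convolution[OF \<chi>D(1)])
    finally show ?thesis .
  qed
  have "(\<Sum>c\<in>C. (\<Sum>x\<in>C. \<chi> x * \<psi> (inv x \<otimes> c)) * \<theta> (inv c)) =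
      (\<Sum>c\<in>C. \<Sum>\<eta>\<in>Irr CG. of_nat (M \<psi> \<eta> * M \<chi> \<eta>) * (?k / \<eta> \<one>) * (\<eta> c * \<theta> (inv\<^bsub>CG\<^esub> c)))"
    by (intro sum.cong refl) (simp add: conv sum_distrib_right C_inv mult.assoc)
  also have "\<dots> = (\<Sum>\<eta>\<in>Irr CG. of_nat (M \<psi> \<eta> * M \<chi> \<eta>) * (?k / \<eta> \<one>) * (\<Sum>c\<in>C. \<eta> c * \<theta> (inv\<^bsub>CG\<^esub> c)))"
    by (subst sum.swap) (simp add: sum_distrib_left)
  also have "\<dots> = (\<Sum>\<eta>\<in>Irr CG. if \<eta> = \<theta> then of_nat (M \<psi> \<theta> * M \<chi> \<theta>) * (?k / \<theta> \<one>) * ?k else 0)"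
    using C.Irr_orthogonality[OF _ \<theta>] by (intro sum.cong refl) auto
  also have "\<dots> = of_nat (M \<psi> \<theta> * M \<chi> \<theta>) * (?k / \<theta> \<one>) * ?k"
    using \<theta> C.finite_Irr by simp
  finally have eq: "of_nat (M \<psi> \<theta> * M \<chi> \<theta>) * (?k / \<theta> \<one>) * ?k = (\<Sum>c\<in>C. - (of_nat p * r c) * \<theta> (inv c))"
    using r(2) by (simp add: eq_neg_iff_add_eq_0[symmetric])
  have one: "\<theta> \<one> \<noteq> 0" using C.Irr_one_nonzero[OF \<theta>] by simp
  have "of_nat (M \<psi> \<theta> * M \<chi> \<theta> * card C * card C) = \<theta> \<one> * (\<Sum>c\<in>C. - (of_nat p * r c) * \<theta> (inv c))"
    unfolding eq[symmetric] using one by simp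
  also have "\<dots> = of_nat p * (0 - \<theta> \<one> * (\<Sum>c\<in>C. r c * \<theta> (inv c)))"
    by (simp add: sum_distrib_left sum_negf mult_ac)
  finally have "p dvd M \<psi> \<theta> * M \<chi> \<theta> * card C * card C"
  proof (rule dvd_of_root_sums)
    have "\<theta> \<one> * (\<Sum>c\<in>C. r c * \<theta> (inv c)) \<in> root_sums"
      using C.Irr_root_sums[OF \<theta>] r(1) by (auto intro!: root_sums_mult root_sums_sum)
    then show "0 - \<theta> \<one> * (\<Sum>c\<in>C. r c * \<theta> (inv c)) \<in> root_sums"
      by (rule root_sums_diff[OF root_sums.zero])
  qed
  then show ?thesis using coprime_C prime by (auto simp: prime_dvd_mult_iff)
qed

text \<open>The column relations of \<open>G\<close> count elements conjugating \<open>d\<close> into \<open>inv c\<close>; for \<open>c\<close>, \<open>d\<close> in \<open>C\<close>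
  the group \<open>P\<close> permutes them, so the count agrees modulo \<open>p\<close> with the one in \<open>C\<close>.\<close>
lemma M_columns_orthogonal:
  assumes \<theta>: "\<theta> \<in> Irr CG" and \<eta>: "\<eta> \<in> Irr CG" and ne: "\<theta> \<noteq> \<eta>"
  shows "p dvd (\<Sum>\<chi>\<in>Irr_inv A act P G. M \<chi> \<theta> * M \<chi> \<eta>)"
proof -
  define N where "N c d = {g \<in> carrier G. c \<otimes> g \<otimes> d \<otimes> inv g = \<one>}" for c d
  have "\<exists>r. r \<in> root_sums \<and> (\<Sum>\<chi>\<in>Irr G. \<chi> c * \<chi> d) = (\<Sum>\<xi>\<in>Irr CG. \<xi> c * \<xi> d) + of_nat p * r"
    if c: "c \<in> C" and d: "d \<in> C" for c d
  proof -
    note cd = C_sub[OF c] C_sub[OF d]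
    obtain r where r: "r \<in> root_sums"
      "(\<Sum>x\<in>N c d. 1 :: complex) = (\<Sum>x\<in>{x \<in> N c d. \<forall>a\<in>P. act a x = x}. 1) + of_nat p * r"
    proof (rule sum_congruence[of "N c d" act "\<lambda>_. 1"])
      fix a x assume a: "a \<in> P" and x: "x \<in> N c d"
      have xG: "x \<in> carrier G" using x by (simp add: N_def)
      have "c \<otimes> act a x \<otimes> d \<otimes> inv (act a x) = act a (c \<otimes> x \<otimes> d \<otimes> inv x)"
        using a xG cd P_sub by (simp add: act_mult_hom act_inv C_fix[OF c] C_fix[OF d])
      then show "act a x \<in> N c d" using x a xG P_sub by (simp add: N_def act_unit)
    qed (use finite_carrier act_mult act_one P_sub root_sums_of_nat[of 1] in \<open>auto simp: N_def\<close>)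
    have "{x \<in> N c d. \<forall>a\<in>P. act a x = x} = {g \<in> C. c \<otimes> g \<otimes> d \<otimes> inv\<^bsub>CG\<^esub> g = \<one>}"
    proof (intro equalityI subsetI)
      fix x assume x: "x \<in> {x \<in> N c d. \<forall>a\<in>P. act a x = x}"
      then have "x \<in> C" by (simp add: N_def C_def fixed_points_def)
      with x show "x \<in> {g \<in> C. c \<otimes> g \<otimes> d \<otimes> inv\<^bsub>CG\<^esub> g = \<one>}" by (simp add: N_def C_inv)
    qed (auto simp: N_def C_inv C_sub C_fix)
    then show ?thesis
      using r Irr_column_orthogonality[OF cd] C.Irr_column_orthogonality[of c d] c d
      by (auto simp: N_def)
  qed
  note ex = this
  define r where "r c d = (SOME r. r \<in> root_sums \<and>
      (\<Sum>\<chi>\<in>Irr G. \<chi> c * \<chi> d) = (\<Sum>\<xi>\<in>Irr CG. \<xi> c * \<xi> d) + of_nat p * r)" for c d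
  have r: "r c d \<in> root_sums"
    "(\<Sum>\<chi>\<in>Irr G. \<chi> c * \<chi> d) = (\<Sum>\<xi>\<in>Irr CG. \<xi> c * \<xi> d) + of_nat p * r c d"
    if "c \<in> C" "d \<in> C" for c d
    using someI_ex[OF ex[OF that]] unfolding r_def by auto
  have expand: "(\<Sum>\<chi>\<in>I. (\<Sum>c\<in>C. \<chi> c * \<theta> (inv c)) * (\<Sum>d\<in>C. \<chi> d * \<eta> (inv d))) =
      (\<Sum>c\<in>C. \<Sum>d\<in>C. \<theta> (inv c) * \<eta> (inv d) * (\<Sum>\<chi>\<in>I. \<chi> c * \<chi> d))" for I :: "('g \<Rightarrow> complex) set"
  proof -
    have "(\<Sum>\<chi>\<in>I. (\<Sum>c\<in>C. \<chi> c * \<theta> (inv c)) * (\<Sum>d\<in>C. \<chi> d * \<eta> (inv d))) =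
        (\<Sum>\<chi>\<in>I. \<Sum>c\<in>C. \<Sum>d\<in>C. \<theta> (inv c) * \<eta> (inv d) * (\<chi> c * \<chi> d))"
      unfolding sum_product by (intro sum.cong refl) (simp only: mult_ac)
    also have "\<dots> = (\<Sum>c\<in>C. \<Sum>\<chi>\<in>I. \<Sum>d\<in>C. \<theta> (inv c) * \<eta> (inv d) * (\<chi> c * \<chi> d))"
      by (rule sum.swap)
    also have "\<dots> = (\<Sum>c\<in>C. \<Sum>d\<in>C. \<Sum>\<chi>\<in>I. \<theta> (inv c) * \<eta> (inv d) * (\<chi> c * \<chi> d))"
      by (rule sum.cong[OF refl], rule sum.swap)
    finally show ?thesis by (simp add: sum_distrib_left)
  qed
  have orth: "(\<Sum>c\<in>C. \<xi> c * \<theta> (inv c)) * (\<Sum>d\<in>C. \<xi> d * \<eta> (inv d)) = 0" if "\<xi> \<in> Irr CG" for \<xi>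
  proof -
    have "(\<Sum>c\<in>C. \<xi> c * \<theta> (inv c)) = (if \<xi> = \<theta> then of_nat (card C) else 0)" if "\<theta> \<in> Irr CG" for \<theta>
      using C.Irr_orthogonality[OF \<open>\<xi> \<in> Irr CG\<close> that] by (simp add: C_inv)
    then show ?thesis using \<theta> \<eta> ne by auto
  qed
  define S where "S = (\<Sum>\<chi>\<in>Irr G. M \<chi> \<theta> * M \<chi> \<eta>)"
  have "of_nat (card C * card C * S) =
      (\<Sum>\<chi>\<in>Irr G. (\<Sum>c\<in>C. \<chi> c * \<theta> (inv c)) * (\<Sum>d\<in>C. \<chi> d * \<eta> (inv d)))"
    by (simp add: S_def M_inner \<theta> \<eta> sum_distrib_left mult_ac)
  also have "\<dots> = (\<Sum>c\<in>C. \<Sum>d\<in>C. \<theta> (inv c) * \<eta> (inv d) * (\<Sum>\<xi>\<in>Irr CG. \<xi> c * \<xi> d)) +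
      of_nat p * (\<Sum>c\<in>C. \<Sum>d\<in>C. \<theta> (inv c) * \<eta> (inv d) * r c d)"
    unfolding expand by (simp add: r(2) distrib_left sum.distrib sum_distrib_left mult_ac)
  also have "(\<Sum>c\<in>C. \<Sum>d\<in>C. \<theta> (inv c) * \<eta> (inv d) * (\<Sum>\<xi>\<in>Irr CG. \<xi> c * \<xi> d)) = 0"
    unfolding expand[symmetric] by (simp add: orth)
  finally have "of_nat (card C * card C * S) = of_nat p * (\<Sum>c\<in>C. \<Sum>d\<in>C. \<theta> (inv c) * \<eta> (inv d) * r c d)"
    by simp
  then have "p dvd card C * card C * S"
    by (rule dvd_of_root_sums)
      (use r(1) C.Irr_root_sums[OF \<theta>] C.Irr_root_sums[OF \<eta>] in \<open>auto intro!: root_sums_sum root_sums_mult\<close>)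
  then have "p dvd S" using coprime_C prime by (auto simp: prime_dvd_mult_iff)
  then obtain s where s: "S = p * s" by blast
  have res: "restrict (conj_char a \<chi>) C = restrict \<chi> C" if "a \<in> P" for a \<chi>
    using subgroup.m_inv_closed[OF P_subgroup that] C_sub C_fix by (auto simp: conj_char_apply fun_eq_iff)
  obtain t where t: "t \<in> root_sums" "(\<Sum>\<chi>\<in>Irr G. of_nat (M \<chi> \<theta> * M \<chi> \<eta>)) =
      (\<Sum>\<chi>\<in>Irr_inv A act P G. of_nat (M \<chi> \<theta> * M \<chi> \<eta>)) + of_nat p * t"
    by (rule sum_Irr_inv[of "\<lambda>\<chi>. of_nat (M \<chi> \<theta> * M \<chi> \<eta>)"],
        simp only: res, rule root_sums_of_nat, rule that)
  have "of_nat (\<Sum>\<chi>\<in>Irr_inv A act P G. M \<chi> \<theta> * M \<chi> \<eta>) = of_nat p * (of_nat s - t)"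
  proof -
    have "of_nat (\<Sum>\<chi>\<in>Irr_inv A act P G. M \<chi> \<theta> * M \<chi> \<eta>) + of_nat p * t = of_nat S"
      by (simp only: S_def of_nat_sum t(2))
    then show ?thesis by (simp only: s of_nat_mult right_diff_distrib eq_diff_eq)
  qed
  then show ?thesis by (rule dvd_of_root_sums) (intro root_sums_diff root_sums_of_nat t)
qed

text \<open>In the product of the columns of \<open>\<theta>\<close> and \<open>\<eta>\<close> all terms but the one at \<open>\<chi>\<close> vanish modulo \<open>p\<close>
  by \<open>M_column\<close>, and so does the whole product.\<close>
lemma M_row_unique:
  assumes \<chi>: "\<chi> \<in> Irr_inv A act P G" and \<theta>: "\<theta> \<in> Irr CG" "\<not> p dvd M \<chi> \<theta>" and \<eta>: "\<eta> \<in> Irr CG" "\<not> p dvd M \<chi> \<eta>"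
  shows "\<theta> = \<eta>"
proof (rule ccontr)
  assume ne: "\<theta> \<noteq> \<eta>"
  have fin: "finite (Irr_inv A act P G)" using finite_Irr by (simp add: Irr_inv_def)
  have "p dvd (\<Sum>\<psi>\<in>Irr_inv A act P G - {\<chi>}. M \<psi> \<theta> * M \<psi> \<eta>)"
  proof (rule dvd_sum)
    fix \<psi> assume "\<psi> \<in> Irr_inv A act P G - {\<chi>}"
    then have "p dvd M \<psi> \<theta>" using M_column[OF _ \<chi> _ \<theta>(1), of \<psi>] \<theta>(2) by auto
    then show "p dvd M \<psi> \<theta> * M \<psi> \<eta>" by simp
  qed
  moreover have "p dvd (\<Sum>\<psi>\<in>Irr_inv A act P G. M \<psi> \<theta> * M \<psi> \<eta>)"
    by (rule M_columns_orthogonal[OF \<theta>(1) \<eta>(1) ne])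
  ultimately have "p dvd M \<chi> \<theta> * M \<chi> \<eta>"
    using \<chi> fin by (simp add: sum.remove dvd_add_left_iff)
  then show False using \<theta>(2) \<eta>(2) prime by (simp add: prime_dvd_mult_iff)
qed

abbreviation \<pi> where "\<pi> \<equiv> glauberman p act P G"

lemma glauberman_Irr: "\<pi> \<chi> \<in> Irr CG"
  and glauberman_iff: "\<theta> \<in> Irr CG \<Longrightarrow> \<not> p dvd M \<chi> \<theta> \<longleftrightarrow> \<pi> \<chi> = \<theta>"
  if \<chi>: "\<chi> \<in> Irr_inv A act P G"
proof -
  obtain \<theta>0 where \<theta>0: "\<theta>0 \<in> Irr CG" "\<not> p dvd M \<chi> \<theta>0" using M_row_nonzero[OF \<chi>] .
  have "\<pi> \<chi> = (THE \<theta>. \<theta> \<in> Irr CG \<and> \<not> p dvd M \<chi> \<theta>)"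
    by (simp add: glauberman_def C_def Let_def)
  also have "\<dots> = \<theta>0"
    using \<theta>0 M_row_unique[OF \<chi>] by (intro the_equality) auto
  finally have "\<pi> \<chi> = \<theta>0" .
  then show "\<pi> \<chi> \<in> Irr CG" "\<theta> \<in> Irr CG \<Longrightarrow> \<not> p dvd M \<chi> \<theta> \<longleftrightarrow> \<pi> \<chi> = \<theta>"
    using \<theta>0 M_row_unique[OF \<chi>] by auto
qed

lemma glauberman_inj: "inj_on \<pi> (Irr_inv A act P G)"
proof (rule inj_onI)
  fix \<chi> \<psi> assume "\<chi> \<in> Irr_inv A act P G" "\<psi> \<in> Irr_inv A act P G" "\<pi> \<chi> = \<pi> \<psi>"
  then show "\<chi> = \<psi>"
    using M_column[of \<chi> \<psi> "\<pi> \<chi>"] glauberman_Irr glauberman_iff[of \<chi> "\<pi> \<chi>"] glauberman_iff[of \<psi> "\<pi> \<chi>"]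
    by auto
qed

text \<open>Restrict \<open>\<chi>\<close> to \<open>C\<close> through \<open>H\<close>: modulo \<open>p\<close> only the \<open>P\<close>-invariant characters of \<open>H\<close>
  contribute, and at the correspondent of \<open>\<phi>\<close> only \<open>\<phi>\<close> does.\<close>
lemma glauberman_eq_iff_res_mult:
  assumes H: "subgroup H G" "\<And>a x. a \<in> carrier A \<Longrightarrow> x \<in> H \<Longrightarrow> act a x \<in> H" and CH: "C \<subseteq> H"
    and \<chi>: "\<chi> \<in> Irr_inv A act P G" and \<phi>: "\<phi> \<in> Irr_inv A act P (G\<lparr>carrier := H\<rparr>)"
  shows "\<pi> \<chi> = glauberman p act P (G\<lparr>carrier := H\<rparr>) \<phi> \<longleftrightarrow> \<not> p dvd res_mult H \<chi> \<phi>"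
    and "inj_on (glauberman p act P (G\<lparr>carrier := H\<rparr>)) (Irr_inv A act P (G\<lparr>carrier := H\<rparr>))"
proof -
  let ?H = "G\<lparr>carrier := H\<rparr>"
  have HG: "H \<subseteq> carrier G" using H(1) by (rule subgroup.subset)
  have "card H dvd card (carrier G)"
    using lagrange[OF H(1)] unfolding Coset.order_def by (metis dvd_triv_right)
  then have cop: "\<not> p dvd card H" using coprime dvd_trans by blast
  interpret H: coprime_p_action A ?H act p P
    using automorphism_action_subgroup[OF H] prime P cop
    by (auto simp: coprime_p_action_def coprime_p_action_axioms_def)
  have HC: "H.C = C"
    using CH HG by (auto simp: H.C_def C_def fixed_points_def)
  show "inj_on (glauberman p act P ?H) (Irr_inv A act P ?H)" by (rule H.glauberman_inj)
  define \<theta> where "\<theta> = H.\<pi> \<phi>"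
  note \<chi>D = Irr_invD[OF \<chi>] note \<phi>D = H.Irr_invD[OF \<phi>]
  have \<theta>: "\<theta> \<in> Irr CG" using H.glauberman_Irr[OF \<phi>] by (simp add: \<theta>_def HC)
  have Minv: "inv\<^bsub>?H\<^esub> x = inv x" if "x \<in> C" for x
    using that CH by (intro m_inv_consistent[OF H(1)]) auto
  have "of_nat (card C) * of_nat (M \<chi> \<theta>) = (\<Sum>x\<in>C. \<chi> x * \<theta> (inv x))"
    by (rule M_inner[OF \<chi>D(1) \<theta>, symmetric])
  also have "\<dots> = (\<Sum>x\<in>C. \<Sum>\<psi>\<in>Irr ?H. of_nat (res_mult H \<chi> \<psi>) * (\<psi> x * \<theta> (inv\<^bsub>?H\<^esub> x)))"
    using CH by (intro sum.cong refl, subst res_mult_inner(1)[OF H(1) \<chi>D(1)])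
      (auto simp: sum_distrib_right Minv mult.assoc)
  also have "\<dots> = (\<Sum>\<psi>\<in>Irr ?H. of_nat (res_mult H \<chi> \<psi>) * (\<Sum>x\<in>C. \<psi> x * \<theta> (inv\<^bsub>?H\<^esub> x)))"
    by (subst sum.swap) (simp add: sum_distrib_left)
  also have "\<dots> = (\<Sum>\<psi>\<in>Irr ?H. of_nat (res_mult H \<chi> \<psi>) * (of_nat (card C) * of_nat (H.M \<psi> \<theta>)))"
    using H.M_inner \<theta> by (intro sum.cong refl) (simp add: HC)
  also have "\<dots> = of_nat (card C) * of_nat (\<Sum>\<psi>\<in>Irr ?H. res_mult H \<chi> \<psi> * H.M \<psi> \<theta>)"
    by (simp add: sum_distrib_left mult_ac)
  finally have MS: "M \<chi> \<theta> = (\<Sum>\<psi>\<in>Irr ?H. res_mult H \<chi> \<psi> * H.M \<psi> \<theta>)"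
    using C.card_pos unfolding mult_cancel_left of_nat_eq_iff by simp
  obtain t where t: "t \<in> root_sums" "(\<Sum>\<psi>\<in>Irr ?H. of_nat (res_mult H \<chi> \<psi> * H.M \<psi> \<theta>)) =
      (\<Sum>\<psi>\<in>Irr_inv A act P ?H. of_nat (res_mult H \<chi> \<psi> * H.M \<psi> \<theta>)) + of_nat p * t"
  proof (rule H.sum_Irr_inv[of "\<lambda>\<psi>. of_nat (res_mult H \<chi> \<psi> * H.M \<psi> \<theta>)"])
    fix a \<psi> assume a: "a \<in> P" and \<psi>: "\<psi> \<in> Irr ?H"
    have "conj_char a \<chi> = \<chi>" using \<chi> a by (simp add: Irr_inv_def)
    then have "res_mult H \<chi> (H.conj_char a \<psi>) = res_mult H \<chi> \<psi>"
      using res_mult_conj_char[OF H \<chi>D(1) \<psi> P_sub[OF a]] by simp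
    moreover have "restrict (H.conj_char a \<psi>) H.C = restrict \<psi> H.C"
      using subgroup.m_inv_closed[OF P_subgroup a] H.C_sub H.C_fix
      by (auto simp: H.conj_char_apply fun_eq_iff)
    ultimately show "of_nat (res_mult H \<chi> (H.conj_char a \<psi>) * H.M (H.conj_char a \<psi>) \<theta>) =
        of_nat (res_mult H \<chi> \<psi> * H.M \<psi> \<theta>)" by simp
  qed (rule root_sums_of_nat, rule that)
  define S where "S = (\<Sum>\<psi>\<in>Irr_inv A act P ?H. res_mult H \<chi> \<psi> * H.M \<psi> \<theta>)"
  have MSt: "of_nat (M \<chi> \<theta>) = of_nat S + of_nat p * t"
    using t(2) by (simp add: MS S_def)
  have "p dvd M \<chi> \<theta> \<longleftrightarrow> p dvd S"
  proof
    assume "p dvd M \<chi> \<theta>"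
    then obtain s where "M \<chi> \<theta> = p * s" by blast
    then have "of_nat S = of_nat p * (of_nat s - t)" using MSt by (simp add: algebra_simps)
    then show "p dvd S" by (rule dvd_of_root_sums) (intro root_sums_diff root_sums_of_nat t)
  next
    assume "p dvd S"
    then obtain s where "S = p * s" by blast
    then have "of_nat (M \<chi> \<theta>) = of_nat p * (of_nat s + t)" using MSt by (simp add: algebra_simps)
    then show "p dvd M \<chi> \<theta>" by (rule dvd_of_root_sums) (intro root_sums_add root_sums_of_nat t)
  qed
  also have \<phi>\<theta>: "\<not> p dvd H.M \<phi> \<theta>"
    using H.glauberman_iff[OF \<phi>, of \<theta>] \<theta> by (simp add: HC \<theta>_def)
  have "p dvd (\<Sum>\<psi>\<in>Irr_inv A act P ?H - {\<phi>}. res_mult H \<chi> \<psi> * H.M \<psi> \<theta>)"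
  proof (rule dvd_sum)
    fix \<psi> assume "\<psi> \<in> Irr_inv A act P ?H - {\<phi>}"
    then have "p dvd H.M \<psi> \<theta>" using H.M_column[OF _ \<phi>, of \<psi> \<theta>] \<theta> \<phi>\<theta> by (auto simp: HC)
    then show "p dvd res_mult H \<chi> \<psi> * H.M \<psi> \<theta>" by simp
  qed
  then have "p dvd S \<longleftrightarrow> p dvd res_mult H \<chi> \<phi> * H.M \<phi> \<theta>"
    using \<phi> H.finite_Irr by (simp add: S_def Irr_inv_def sum.remove[of _ \<phi>] dvd_add_left_iff)
  also have "\<dots> \<longleftrightarrow> p dvd res_mult H \<chi> \<phi>"
    using \<phi>\<theta> prime by (simp add: prime_dvd_mult_iff)
  finally show "\<pi> \<chi> = glauberman p act P ?H \<phi> \<longleftrightarrow> \<not> p dvd res_mult H \<chi> \<phi>"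
    using glauberman_iff[OF \<chi> \<theta>] by (simp add: \<theta>_def)
qed

end

section \<open>Stabilizers of corresponding characters\<close>

lemma subnormal_subgroup:
  assumes "group A" "subnormal A K"
  shows "subgroup K A"
  using assms(2)
proof induction
  case self
  show ?case by (rule group.subgroup_self[OF assms(1)])
next
  case (step K N)
  then show ?case
    using group.incl_subgroup[OF assms(1)] normal_imp_subgroup by blast
qed

lemma (in group) p_subgroup_conjugate:
  assumes "p_subgroup p P G" "t \<in> carrier G"
  shows "p_subgroup p ((\<lambda>b. t \<otimes> b \<otimes> inv t) ` P) G"
proof -
  let ?c = "\<lambda>b. t \<otimes> b \<otimes> inv t"
  have P: "subgroup P G" using assms by (simp add: p_subgroup_def)
  note sub = subgroup.subset[OF P]
  have "?c \<in> hom G G"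
  proof (rule homI)
    fix x y assume xy: "x \<in> carrier G" "y \<in> carrier G"
    have "inv t \<otimes> (t \<otimes> (y \<otimes> inv t)) = y \<otimes> inv t"
      using xy assms(2) by (simp add: m_assoc[symmetric])
    then show "?c (x \<otimes> y) = ?c x \<otimes> ?c y" using xy assms(2) by (simp add: m_assoc)
  qed (use assms(2) in auto)
  then have "subgroup (?c ` P) G"
    using group_hom.subgroup_img_is_subgroup[of G G ?c P] P
    by (simp add: group_hom_def group_hom_axioms_def is_group)
  moreover have "inj_on ?c P"
    using sub assms(2) by (intro inj_onI) (auto simp: subsetD)
  ultimately show ?thesis
    using assms(1) by (simp add: p_subgroup_def card_image)
qed

context automorphism_action
begin

lemma Irr_inv_conj_char:
  assumes "\<chi> \<in> Irr_inv A act P G" "P \<subseteq> carrier A" "t \<in> carrier A"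
  shows "conj_char t \<chi> \<in> Irr_inv A act ((\<lambda>b. t \<otimes>\<^bsub>A\<^esub> b \<otimes>\<^bsub>A\<^esub> inv\<^bsub>A\<^esub> t) ` P) G"
proof -
  have "conj_char (t \<otimes>\<^bsub>A\<^esub> b \<otimes>\<^bsub>A\<^esub> inv\<^bsub>A\<^esub> t) (conj_char t \<chi>) = conj_char t \<chi>" if b: "b \<in> P" for b
  proof -
    have bA: "b \<in> carrier A" using b assms by auto
    have "conj_char (t \<otimes>\<^bsub>A\<^esub> b \<otimes>\<^bsub>A\<^esub> inv\<^bsub>A\<^esub> t) (conj_char t \<chi>) =
        conj_char (t \<otimes>\<^bsub>A\<^esub> b \<otimes>\<^bsub>A\<^esub> inv\<^bsub>A\<^esub> t \<otimes>\<^bsub>A\<^esub> t) \<chi>"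
      using bA assms by (simp add: conj_char_mult)
    also have "t \<otimes>\<^bsub>A\<^esub> b \<otimes>\<^bsub>A\<^esub> inv\<^bsub>A\<^esub> t \<otimes>\<^bsub>A\<^esub> t = t \<otimes>\<^bsub>A\<^esub> b"
      using bA assms by (simp add: A.m_assoc)
    also have "conj_char (t \<otimes>\<^bsub>A\<^esub> b) \<chi> = conj_char t \<chi>"
      using bA b assms by (simp add: conj_char_mult Irr_inv_def)
    finally show ?thesis .
  qed
  then show ?thesis using assms conj_char_Irr by (auto simp: Irr_inv_def)
qed

lemma fixed_points_conjugate_subset:
  assumes "fixed_points act P G \<subseteq> H" "P \<subseteq> carrier A" "t \<in> carrier A"
    and "\<And>x. x \<in> H \<Longrightarrow> act t x \<in> H"
  shows "fixed_points act ((\<lambda>b. t \<otimes>\<^bsub>A\<^esub> b \<otimes>\<^bsub>A\<^esub> inv\<^bsub>A\<^esub> t) ` P) G \<subseteq> H"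
proof
  fix x assume x: "x \<in> fixed_points act ((\<lambda>b. t \<otimes>\<^bsub>A\<^esub> b \<otimes>\<^bsub>A\<^esub> inv\<^bsub>A\<^esub> t) ` P) G"
  then have xG: "x \<in> carrier G" by (simp add: fixed_points_def)
  define y where "y = act (inv\<^bsub>A\<^esub> t) x"
  have "act b y = y" if b: "b \<in> P" for b
  proof -
    have bA: "b \<in> carrier A" using b assms by auto
    have "act t (act b y) = act (t \<otimes>\<^bsub>A\<^esub> b \<otimes>\<^bsub>A\<^esub> inv\<^bsub>A\<^esub> t) x"
      using bA xG assms by (simp add: act_mult y_def)
    also have "\<dots> = x" using x b by (simp add: fixed_points_def)
    finally have "act (inv\<^bsub>A\<^esub> t) (act t (act b y)) = y" by (simp add: y_def)
    then show ?thesis using bA xG assms by (simp add: y_def)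
  qed
  then have "y \<in> H" using xG assms by (auto simp: y_def fixed_points_def)
  then have "act t y \<in> H" using assms by simp
  then show "x \<in> H" using xG assms by (simp add: y_def)
qed

end

text \<open>The correspondence under \<open>B\<close> only serves to show that \<open>res_mult H \<chi> \<phi>\<close> is prime to \<open>p\<close>. This
  number involves no acting group, so it yields the correspondence under every \<open>p\<close>-subgroup of
  \<open>A\<close> that fixes both characters and has its fixed points in \<open>H\<close>.\<close>
locale corresponding_characters = automorphism_action A G act
  for A :: "('a, 'l) monoid_scheme" and G :: "('g, 'm) monoid_scheme" (structure)
    and act :: "'a \<Rightarrow> 'g \<Rightarrow> 'g" +
  fixes p :: nat and B :: "'a set" and H :: "'g set" and \<chi> \<phi> :: "'g \<Rightarrow> complex"
  assumes prime: "Factorial_Ring.prime p" and B: "p_subgroup p B A"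
    and coprime: "\<not> p dvd card (carrier G)"
    and H: "subgroup H G" and H_inv: "\<And>a x. a \<in> carrier A \<Longrightarrow> x \<in> H \<Longrightarrow> act a x \<in> H"
    and CH: "fixed_points act B G \<subseteq> H"
    and \<chi>: "\<chi> \<in> Irr_inv A act B G" and \<phi>: "\<phi> \<in> Irr_inv A act B (G\<lparr>carrier := H\<rparr>)"
    and corr: "glauberman p act B G \<chi> = glauberman p act B (G\<lparr>carrier := H\<rparr>) \<phi>"
begin

abbreviation HG where "HG \<equiv> G\<lparr>carrier := H\<rparr>"

sublocale H: automorphism_action A HG act
  by (rule automorphism_action_subgroup[OF H H_inv])

lemma coprime_p_actionI: "p_subgroup p P A \<Longrightarrow> coprime_p_action A G act p P"
  using automorphism_action_axioms prime coprime
  by (simp add: coprime_p_action_def coprime_p_action_axioms_def)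

lemma glauberman_eq_iff:
  assumes "p_subgroup p P A" "fixed_points act P G \<subseteq> H"
    "\<chi>' \<in> Irr_inv A act P G" "\<phi>' \<in> Irr_inv A act P HG"
  shows "glauberman p act P G \<chi>' = glauberman p act P HG \<phi>' \<longleftrightarrow> \<not> p dvd res_mult H \<chi>' \<phi>'"
    and "inj_on (glauberman p act P G) (Irr_inv A act P G)"
    and "inj_on (glauberman p act P HG) (Irr_inv A act P HG)"
proof -
  interpret P: coprime_p_action A G act p P by (rule coprime_p_actionI[OF assms(1)])
  have "P.C \<subseteq> H" using assms(2) by (simp add: P.C_def)
  note * = P.glauberman_eq_iff_res_mult[OF H H_inv this assms(3,4)]
  show "glauberman p act P G \<chi>' = glauberman p act P HG \<phi>' \<longleftrightarrow> \<not> p dvd res_mult H \<chi>' \<phi>'"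
    "inj_on (glauberman p act P HG) (Irr_inv A act P HG)" using * by auto
  show "inj_on (glauberman p act P G) (Irr_inv A act P G)" by (rule P.glauberman_inj)
qed

lemma res_mult_coprime: "\<not> p dvd res_mult H \<chi> \<phi>"
  using glauberman_eq_iff(1)[OF B CH \<chi> \<phi>] corr by simp

lemma Irr: "\<chi> \<in> Irr G" "\<phi> \<in> Irr HG"
  using \<chi> \<phi> by (auto simp: Irr_inv_def)

lemma B_sub: "B \<subseteq> carrier A"
  using B by (auto simp: p_subgroup_def dest: subgroup.subset)

lemma glauberman_eq:
  assumes "p_subgroup p P A" "fixed_points act P G \<subseteq> H"
    "P \<subseteq> stabilizer A conj_char \<chi>" "P \<subseteq> stabilizer A H.conj_char \<phi>"
  shows "glauberman p act P G \<chi> = glauberman p act P HG \<phi>"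
  using glauberman_eq_iff(1)[OF assms(1,2), of \<chi> \<phi>] res_mult_coprime Irr assms(3,4)
  by (auto simp: Irr_inv_def stabilizer_def)

text \<open>The conjugate \<open>B'\<close> of \<open>B\<close> by \<open>t\<close> fixes \<open>\<chi>\<close> and \<open>\<phi>\<close>, which therefore correspond under it, and
  also their conjugates by \<open>t\<close>. If \<open>t\<close> fixes one of the characters, then that one has the same
  multiplicity with the conjugate of the other as with the other itself; so these two have the
  same correspondent under \<open>B'\<close> and are equal.\<close>
lemma conjugate_fixed:
  assumes t: "t \<in> carrier A"
    and fixes_both: "(\<lambda>b. t \<otimes>\<^bsub>A\<^esub> b \<otimes>\<^bsub>A\<^esub> inv\<^bsub>A\<^esub> t) ` B \<subseteq> stabilizer A conj_char \<chi>"
      "(\<lambda>b. t \<otimes>\<^bsub>A\<^esub> b \<otimes>\<^bsub>A\<^esub> inv\<^bsub>A\<^esub> t) ` B \<subseteq> stabilizer A H.conj_char \<phi>"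
  shows "conj_char t \<chi> = \<chi> \<longleftrightarrow> H.conj_char t \<phi> = \<phi>"
proof -
  define B' where "B' = (\<lambda>b. t \<otimes>\<^bsub>A\<^esub> b \<otimes>\<^bsub>A\<^esub> inv\<^bsub>A\<^esub> t) ` B"
  have B': "p_subgroup p B' A"
    unfolding B'_def by (rule A.p_subgroup_conjugate[OF B t])
  have C': "fixed_points act B' G \<subseteq> H"
    unfolding B'_def by (rule fixed_points_conjugate_subset[OF CH B_sub t H_inv[OF t]])
  have inv: "\<chi> \<in> Irr_inv A act B' G" "\<phi> \<in> Irr_inv A act B' HG"
    using fixes_both Irr by (auto simp: B'_def Irr_inv_def stabilizer_def)
  have inv_t: "conj_char t \<chi> \<in> Irr_inv A act B' G" "H.conj_char t \<phi> \<in> Irr_inv A act B' HG"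
    unfolding B'_def using Irr_inv_conj_char[OF \<chi> B_sub t] H.Irr_inv_conj_char[OF \<phi> B_sub t] by auto
  note iff = glauberman_eq_iff[OF B' C']
  have eq: "glauberman p act B' G \<chi> = glauberman p act B' HG \<phi>"
    using iff(1)[OF inv] res_mult_coprime by simp
  have mult: "res_mult H (conj_char t \<chi>) (H.conj_char t \<phi>) = res_mult H \<chi> \<phi>"
    by (rule res_mult_conj_char[OF H H_inv Irr t])
  show ?thesis
  proof
    assume "conj_char t \<chi> = \<chi>"
    then have e: "glauberman p act B' G \<chi> = glauberman p act B' HG (H.conj_char t \<phi>)"
      using iff(1)[OF inv(1) inv_t(2)] res_mult_coprime mult by simp
    then show "H.conj_char t \<phi> = \<phi>"
      by (intro inj_onD[OF iff(3)[OF inv] trans[OF e[symmetric] eq] inv_t(2) inv(2)])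
  next
    assume "H.conj_char t \<phi> = \<phi>"
    then have e: "glauberman p act B' G (conj_char t \<chi>) = glauberman p act B' HG \<phi>"
      using iff(1)[OF inv_t(1) inv(2)] res_mult_coprime mult by simp
    then show "conj_char t \<chi> = \<chi>"
      by (intro inj_onD[OF iff(2)[OF inv] trans[OF e eq[symmetric]] inv_t(1) inv(1)])
  qed
qed

text \<open>Induction from the top of the chain: the set on which the stabilizers are assumed to agree
  shrinks from \<open>A\<close> down to \<open>K\<close>, and each step regains the larger member of the chain from the
  normal subgroup below it.\<close>
lemma stabilizers_agree_on_subnormal:
  assumes "subnormal A K" "B \<subseteq> K"
    "stabilizer A conj_char \<chi> \<inter> K = stabilizer A H.conj_char \<phi> \<inter> K"
  shows "stabilizer A conj_char \<chi> = stabilizer A H.conj_char \<phi>"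
  using assms
proof induction
  case self
  then show ?case by (auto simp: stabilizer_def)
next
  case (step K N)
  note K = subnormal_subgroup[OF A.is_group step.hyps(1)]
  have N: "N \<subseteq> K"
    using normal_imp_subgroup[OF step.hyps(2)] subgroup.subset by fastforce
  have "conj_char t \<chi> = \<chi> \<longleftrightarrow> H.conj_char t \<phi> = \<phi>" if t: "t \<in> K" for t
  proof -
    have tA: "t \<in> carrier A" using t subgroup.subset[OF K] by auto
    have N_conj: "t \<otimes>\<^bsub>A\<^esub> b \<otimes>\<^bsub>A\<^esub> inv\<^bsub>A\<^esub> t \<in> N" if "b \<in> N" for b
      using normal.inv_op_closed2[OF step.hyps(2), of t b] t that
      by (simp add: A.m_inv_consistent[OF K])
    let ?c = "\<lambda>b. t \<otimes>\<^bsub>A\<^esub> b \<otimes>\<^bsub>A\<^esub> inv\<^bsub>A\<^esub> t"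
    \<comment> \<open>if \<open>t\<close> fixes one character, so does the conjugate of \<open>B\<close>; being contained in \<open>N\<close>, this
      conjugate then fixes the other one too\<close>
    have fixes_\<chi>: "?c ` B \<subseteq> stabilizer A conj_char \<chi>" if "conj_char t \<chi> = \<chi>"
    proof -
      have "conj_char (?c b) (conj_char t \<chi>) = conj_char t \<chi>" if "b \<in> B" for b
        using Irr_inv_conj_char[OF \<chi> B_sub tA] that by (auto simp: Irr_inv_def)
      then show ?thesis using that B_sub tA by (auto simp: stabilizer_def)
    qed
    have fixes_\<phi>: "?c ` B \<subseteq> stabilizer A H.conj_char \<phi>" if "H.conj_char t \<phi> = \<phi>"
    proof -
      have "H.conj_char (?c b) (H.conj_char t \<phi>) = H.conj_char t \<phi>" if "b \<in> B" for b
        using H.Irr_inv_conj_char[OF \<phi> B_sub tA] that by (auto simp: Irr_inv_def)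
      then show ?thesis using that B_sub tA by (auto simp: stabilizer_def)
    qed
    have "?c ` B \<subseteq> N" using N_conj step.prems(1) by auto
    then have "?c ` B \<subseteq> stabilizer A conj_char \<chi> \<longleftrightarrow> ?c ` B \<subseteq> stabilizer A H.conj_char \<phi>"
      using step.prems(2) by blast
    then show ?thesis using conjugate_fixed[OF tA] fixes_\<chi> fixes_\<phi> by blast
  qed
  then have "stabilizer A conj_char \<chi> \<inter> K = stabilizer A H.conj_char \<phi> \<inter> K"
    by (auto simp: stabilizer_def)
  then show ?case using step.IH step.prems(1) N by blast
qed

lemma stabilizer_eq:
  assumes "subnormal A B"
  shows "stabilizer A conj_char \<chi> = stabilizer A H.conj_char \<phi>"
proof (rule stabilizers_agree_on_subnormal[OF assms])
  show "stabilizer A conj_char \<chi> \<inter> B = stabilizer A H.conj_char \<phi> \<inter> B"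
    using \<chi> \<phi> B_sub by (auto simp: stabilizer_def Irr_inv_def)
qed simp

end

theorem theoremC:
  fixes p :: nat
    and A :: "('a, 'l) monoid_scheme" and G :: "('g, 'm) monoid_scheme"
    and act :: "'a \<Rightarrow> 'g \<Rightarrow> 'g"
    and B :: "'a set" and H :: "'g set" and \<chi> \<phi> :: "'g \<Rightarrow> complex"
  assumes "Factorial_Ring.prime p"
    and "group A" "finite (carrier A)"
    and "group G" "finite (carrier G)"
    and "group_hom A (AutoGroup G) act"
    and "subnormal A B" "p_subgroup p B A"
    and "\<not> p dvd Coset.order G"
    and "subgroup H G" "fixed_points act B G \<subseteq> H"
    and "\<forall>a\<in>carrier A. act a ` H = H"
    and "\<chi> \<in> Irr_inv A act B G"
    and "\<phi> \<in> Irr_inv A act B (G\<lparr>carrier := H\<rparr>)"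
    and "glauberman p act B G \<chi> = glauberman p act B (G\<lparr>carrier := H\<rparr>) \<phi>"
  shows "stabilizer A (char_action A act G) \<chi> = stabilizer A (char_action A act (G\<lparr>carrier := H\<rparr>)) \<phi>
    \<and> (\<forall>D. p_subgroup p D A \<and> D \<subseteq> stabilizer A (char_action A act G) \<chi>
            \<and> fixed_points act D G \<subseteq> H
          \<longrightarrow> glauberman p act D G \<chi> = glauberman p act D (G\<lparr>carrier := H\<rparr>) \<phi>)"
proof -
  interpret act: group_hom A "AutoGroup G" act by fact
  have auto: "act a \<in> hom G G \<inter> Bij (carrier G)" if "a \<in> carrier A" for a
    using act.hom_closed[OF that] by (simp add: AutoGroup_def auto_def)
  have "act (a \<otimes>\<^bsub>A\<^esub> b) x = act a (act b x)"
    if "a \<in> carrier A" "b \<in> carrier A" "x \<in> carrier G" for a b x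
    using act.hom_mult[OF that(1,2)] auto[OF that(1)] auto[OF that(2)] that(3)
    by (simp add: AutoGroup_def BijGroup_def compose_def)
  moreover have "act \<one>\<^bsub>A\<^esub> x = x" if "x \<in> carrier G" for x
    using act.hom_one that by (simp add: AutoGroup_def BijGroup_def)
  ultimately interpret automorphism_action A G act
    using auto assms(2,4,5)
    by (auto simp: automorphism_action_def automorphism_action_axioms_def fin_group_def fin_group_axioms_def)
  interpret corresponding_characters A G act p B H \<chi> \<phi>
    by (intro corresponding_characters.intro corresponding_characters_axioms.intro automorphism_action_axioms)
      (use assms in \<open>auto simp: Coset.order_def\<close>)
  show ?thesis
    using stabilizer_eq[OF assms(7)] glauberman_eq by auto
qed

end
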